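(* Let $p\in[0,1]$ with $pn\in\mathbb{N}$. Let $B$ be a multi-set of $n$ elements of $[0,1]$ and $B^\gamma$ its $\gamma$-discretization, with elements in $I^\gamma$. Let $\mathcal{T}_tB$ be the continuous evolution of $B$, with max-price $q_t$ and bid trajectories $b_t$, $b\in B$, and let $T^\gamma_tB^\gamma$ be the discrete evolution of $B^\gamma$, with max-price $q^\gamma_t$ and corresponding bid trajectories $b^\gamma_t$. Then $$\sup_{t\ge0}|q^\gamma_t-q_t|\le(3n+2)\gamma,\qquad \sup_{b\in B}\sup_{t\ge0}|b^\gamma_t-b_t|\le(3n+2)\gamma .$$
   Context: Continuous evolution. Let $F(x)=\frac1n\sum_{b\in B}\mathbf{1}\{b\le x\}$, $x\in\mathbb{R}$, with left limits $F(x^-)$. The max-price $(q_t)_{t\ge0}$ is the unique solution (continuous and piecewise linear in $t$, with $u_t$ piecewise constant and right-continuous) of $$\frac{dq_t}{dt}=u_t\,\mathbf{1}\{q_t\in(0,1)\},\quad u_t=\frac{w_t-\ell_t}{w_t+\ell_t},\quad w_t=p-F((q_t-t)^-),\quad \ell_t=F(q_t+t)-p,$$ with $q_0=F^{-1}(p)=\inf\{x\ge0:F(x)\ge p\}$. The bid $b\in B$ is at time $t$ at $b_t=b+t$ if $b<q_t-t$, $b_t=q_t$ if $q_t-t\le b\le q_t+t$, $b_t=b-t$ if $b>q_t+t$; $\mathcal{T}_tB=[b_t:b\in B]$ (multi-set). Discrete evolution. Let $\gamma$ be the inverse of a natural number and $I^\gamma=[0,1]\cap\gamma\mathbb{N}=\{0,\gamma,2\gamma,\dots,1\}$.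 The $\gamma$-discretization of $B=[b_1,\dots,b_n]$, $b_1\le\dots\le b_n$, is $B^\gamma=[b^\gamma_1,\dots,b^\gamma_n]$ with $b^\gamma_i=\gamma\lfloor b_i/\gamma\rfloor$. One step $T^\gamma$ acts on a multi-set of $n$ elements of $I^\gamma$, listed in nondecreasing order $b'_1\le\dots\le b'_n$, by increasing $b'_1,\dots,b'_{np}$ (winners) by $\gamma$ and decreasing $b'_{np+1},\dots,b'_n$ (losers) by $\gamma$, with bids kept in $[0,1]$ (a winner at $1$ stays at $1$, a loser at $0$ stays at $0$). Put $T^\gamma_tB^\gamma=(T^\gamma)^{\lfloor t/\gamma\rfloor}B^\gamma$; $q^\gamma_t$ is the $np$-th smallest element $b'_{np}$ of $T^\gamma_tB^\gamma$, and, for $b=b_i\in B$, $b^\gamma_t$ is the position at time $t$ of the bid started at $b^\gamma_i$.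
   Formalization: If q_0 is 0 or 1 with u pointing inward (B=[1,1,1], p=1/3), the literal equation also allows q frozen there, and the bound fails; so for t>0 the max-price must satisfy u_t≤0 where q_t=0 and u_t≥0 where q_t=1. For pn=0, q^γ_t is set to 0. *)

theory Defs
  imports Complex_Main "HOL-Library.Multiset" "HOL-Library.Extended_Real"
begin

definition cdf :: "real multiset \<Rightarrow> real \<Rightarrow> real" where
  "cdf B x = (\<Sum>b\<in>#B. of_bool (b \<le> x)) / real (size B)"

definition cdf_left :: "real multiset \<Rightarrow> real \<Rightarrow> real" where
  "cdf_left B x = Lim (at_left x) (cdf B)"

definition quantile :: "real multiset \<Rightarrow> real \<Rightarrow> real" where
  "quantile B p = Inf {x. 0 \<le> x \<and> p \<le> cdf B x}"

definition win_rate :: "real \<Rightarrow> real multiset \<Rightarrow> (real \<Rightarrow> real) \<Rightarrow> real \<Rightarrow> real" where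
  "win_rate p B q t = p - cdf_left B (q t - t)"

definition lose_rate :: "real \<Rightarrow> real multiset \<Rightarrow> (real \<Rightarrow> real) \<Rightarrow> real \<Rightarrow> real" where
  "lose_rate p B q t = cdf B (q t + t) - p"

text \<open>The denominator below can only vanish for \<open>p = 0\<close>; then \<open>q\<close> is constantly \<open>0\<close> and the
  value \<open>0 / 0 = 0\<close> is immaterial.\<close>

definition drift :: "real \<Rightarrow> real multiset \<Rightarrow> (real \<Rightarrow> real) \<Rightarrow> real \<Rightarrow> real" where
  "drift p B q t =
    (win_rate p B q t - lose_rate p B q t) / (win_rate p B q t + lose_rate p B q t)"

text \<open>\<open>S\<close> is the locally finite set of breakpoints: between them \<open>q\<close> is affine and the drift is
  constant, and outside them the differential equation holds.

  The last clause selects a solution when \<open>q 0 \<in> {0, 1}\<close>. There the equation, with the indicator of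
  \<open>0 < q t < 1\<close>, is also solved by a path resting at the endpoint although the drift points into
  the unit interval (for example \<open>B = {#1, 1, 1#}\<close>, \<open>p = 1/3\<close>: drift \<open>-1/3\<close>). The indicator is meant
  to stop \<open>q\<close> from leaving the unit interval, so \<open>q\<close> may rest at an endpoint only while the
  drift does not point inwards. Time \<open>0\<close> is excluded, as \<open>q\<close> may start at an endpoint and leave it at
  once. For \<open>0 < q 0 < 1\<close> the clause follows from the others.\<close>

definition max_price :: "real \<Rightarrow> real multiset \<Rightarrow> (real \<Rightarrow> real) \<Rightarrow> bool" where
  "max_price p B q \<longleftrightarrow>
    q 0 = quantile B p \<and>
    continuous_on {0..} q \<and>
    (\<forall>t\<ge>0. continuous (at_right t) (drift p B q)) \<and>
    (\<exists>S. (\<forall>T. finite (S \<inter> {0..T})) \<and>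
      (\<forall>a b. 0 \<le> a \<longrightarrow> {a<..<b} \<inter> S = {} \<longrightarrow>
        (\<exists>c d. \<forall>t\<in>{a<..<b}. q t = c * t + d) \<and> (\<exists>v. \<forall>t\<in>{a<..<b}. drift p B q t = v)) \<and>
      (\<forall>t>0. t \<notin> S \<longrightarrow>
        (q has_real_derivative drift p B q t * of_bool (q t \<in> {0<..<1})) (at t))) \<and>
    (\<forall>t>0. (q t = 0 \<longrightarrow> drift p B q t \<le> 0) \<and> (q t = 1 \<longrightarrow> drift p B q t \<ge> 0))"

definition bid_at :: "(real \<Rightarrow> real) \<Rightarrow> real \<Rightarrow> real \<Rightarrow> real" where
  "bid_at q t b =
    (if b < q t - t then b + t else if b \<le> q t + t then q t else b - t)"

definition discretize :: "real \<Rightarrow> real \<Rightarrow> real" where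
  "discretize \<gamma> b = \<gamma> * of_int \<lfloor>b / \<gamma>\<rfloor>"

text \<open>The number \<open>n p\<close>, which is an integer wherever it is used.\<close>

definition num_winners :: "real \<Rightarrow> nat \<Rightarrow> nat" where
  "num_winners p n = nat \<lfloor>real n * p\<rfloor>"

text \<open>New position of a bid at \<open>x\<close> which is the \<open>i\<close>-th smallest, counting from \<open>0\<close>, when there are
  \<open>m\<close> winners.\<close>

definition move :: "real \<Rightarrow> nat \<Rightarrow> nat \<Rightarrow> real \<Rightarrow> real" where
  "move \<gamma> m i x = (if i < m then min 1 (x + \<gamma>) else max 0 (x - \<gamma>))"

definition discrete_step :: "real \<Rightarrow> real \<Rightarrow> real multiset \<Rightarrow> real multiset" where
  "discrete_step \<gamma> p M = (let xs = sorted_list_of_multiset M; n = size M in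
    mset (map (\<lambda>i. move \<gamma> (num_winners p n) i (xs ! i)) [0..<n]))"

definition num_steps :: "real \<Rightarrow> real \<Rightarrow> nat" where
  "num_steps \<gamma> t = nat \<lfloor>t / \<gamma>\<rfloor>"

definition discrete_evolution :: "real \<Rightarrow> real \<Rightarrow> real multiset \<Rightarrow> real \<Rightarrow> real multiset" where
  "discrete_evolution \<gamma> p B t =
    (discrete_step \<gamma> p ^^ num_steps \<gamma> t) (image_mset (discretize \<gamma>) B)"

text \<open>For \<open>n p = 0\<close> there is no \<open>n p\<close>-th smallest bid; the max-price is then \<open>0\<close>, in accordance with
  \<open>quantile B 0 = 0\<close>.\<close>

definition discrete_max_price :: "real \<Rightarrow> real \<Rightarrow> real multiset \<Rightarrow> real \<Rightarrow> real" where
  "discrete_max_price \<gamma> p B t = (let m = num_winners p (size B) in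
    if m = 0 then 0 else sorted_list_of_multiset (discrete_evolution \<gamma> p B t) ! (m - 1))"

text \<open>\<open>x k i\<close> is the position after \<open>k\<close> steps of the bid started at the discretization of the
  \<open>i\<close>-th smallest element of \<open>B\<close>. A nondecreasing listing \<open>\<sigma>\<close> of the bids is not unique when positions
  coincide, and any choice of listing is allowed in each step. This affects the individual
  trajectories but not the multiset of positions.\<close>

definition discrete_trajectories ::
    "real \<Rightarrow> real \<Rightarrow> real multiset \<Rightarrow> (nat \<Rightarrow> nat \<Rightarrow> real) \<Rightarrow> bool" where
  "discrete_trajectories \<gamma> p B x \<longleftrightarrow> (let n = size B in
    (\<forall>i<n. x 0 i = discretize \<gamma> (sorted_list_of_multiset B ! i)) \<and>
    (\<forall>k. \<exists>\<sigma>. bij_betw \<sigma> {..<n} {..<n} \<and> mono_on {..<n} (\<lambda>j. x k (\<sigma> j)) \<and>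
      (\<forall>j<n. x (Suc k) (\<sigma> j) = move \<gamma> (num_winners p n) j (x k (\<sigma> j)))))"

end

(* The bid started at b is at time t at the point of [b - t, b + t] closest to q_t, and summing over
   all bids, whose total changes at rate 2 n p - n while 0 < q < 1, yields an equation in which only
   q_t and t occur:  sum_i clamp(q_t; b_i - t, b_i + t) = sum_i b_i + (2 n p - n) t.
   The discrete evolution satisfies the same equation approximately, since a discrete bid either has
   always won, or has always lost, or is within 2 \<gamma> of the discrete price. The left-hand side is
   increasing in the price, with slope at least the number of bids at the price, so the two prices
   differ by O(n \<gamma>). At the endpoints of the unit interval the equation becomes an inequality; its
   failing direction is repaired by starting again from the last time at which the discrete price
   was at that endpoint, where all bids near the price are known up to \<gamma>. *)
theory Submission
  imports Defs
begin

definition clamp :: "real \<Rightarrow> real \<Rightarrow> real \<Rightarrow> real" where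
  "clamp b t r = max (b - t) (min (b + t) r)"

lemma clamp_mono: "r \<le> r' \<Longrightarrow> clamp b t r \<le> clamp b t r'"
  unfolding clamp_def by linarith

lemma clamp_lipschitz: "\<bar>clamp b t r - clamp b' t' r'\<bar> \<le> max (\<bar>b - b'\<bar> + \<bar>t - t'\<bar>) \<bar>r - r'\<bar>"
  unfolding clamp_def by linarith

lemma bid_at_clamp: "t \<ge> 0 \<Longrightarrow> bid_at q t b = clamp b t (q t)"
  unfolding bid_at_def clamp_def by auto

section \<open>The discrete evolution\<close>

locale discrete_bids =
  fixes \<gamma> :: real and N n m :: nat and x :: "nat \<Rightarrow> nat \<Rightarrow> real" and Q :: "nat \<Rightarrow> real"
    and W :: "nat \<Rightarrow> nat set"
  assumes mesh: "\<gamma> > 0" "\<gamma> * real N = 1"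
    and grid0: "\<And>i. i < n \<Longrightarrow> \<exists>z. x 0 i = \<gamma> * of_int z"
    and range0: "\<And>i. i < n \<Longrightarrow> 0 \<le> x 0 i \<and> x 0 i \<le> 1"
    and W_subset: "\<And>k. W k \<subseteq> {..<n}"
    and card_W: "\<And>k. card (W k) = m"
    and holder: "\<And>k. \<exists>i\<in>W k. x k i = Q k"
    and winner_le: "\<And>k i. i \<in> W k \<Longrightarrow> x k i \<le> Q k"
    and winner_step: "\<And>k i. i \<in> W k \<Longrightarrow> x (Suc k) i = min 1 (x k i + \<gamma>)"
    and loser_ge: "\<And>k i. i < n \<Longrightarrow> i \<notin> W k \<Longrightarrow> Q k \<le> x k i"
    and loser_step: "\<And>k i. i < n \<Longrightarrow> i \<notin> W k \<Longrightarrow> x (Suc k) i = max 0 (x k i - \<gamma>)"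
begin

lemma finite_W: "finite (W k)"
  using W_subset finite_subset by blast

lemma m_le_n: "m \<le> n"
  using card_mono[OF _ W_subset[of 0]] card_W[of 0] by simp

lemma m_pos: "0 < m"
  using holder[of 0] card_W[of 0] finite_W card_gt_0_iff by fastforce

lemma grid: "i < n \<Longrightarrow> \<exists>z. x k i = \<gamma> * of_int z"
proof (induction k)
  case 0
  then show ?case by (rule grid0)
next
  case (Suc k)
  obtain z where z: "x k i = \<gamma> * of_int z" using Suc by blast
  have up: "x k i + \<gamma> = \<gamma> * of_int (z + 1)" and down: "x k i - \<gamma> = \<gamma> * of_int (z - 1)"
    using z by (simp_all add: algebra_simps)
  have one: "1 = \<gamma> * of_int (int N)" and zero: "0 = \<gamma> * of_int 0" using mesh by simp_all
  show ?case
  proof (cases "i \<in> W k")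
    case True
    then have "x (Suc k) i = 1 \<or> x (Suc k) i = x k i + \<gamma>"
      using winner_step[of i k] by (auto simp: min_def)
    then show ?thesis using up one by metis
  next
    case False
    then have "x (Suc k) i = 0 \<or> x (Suc k) i = x k i - \<gamma>"
      using loser_step[OF Suc.prems] by (auto simp: max_def)
    then show ?thesis using down zero by metis
  qed
qed

lemma x_range: "i < n \<Longrightarrow> 0 \<le> x k i \<and> x k i \<le> 1"
proof (induction k)
  case 0
  then show ?case by (rule range0)
next
  case (Suc k)
  then show ?case
    using winner_step[of i k] loser_step[of i k] mesh by (cases "i \<in> W k") auto
qed

lemma Q_attained: "\<exists>i<n. x k i = Q k"
  using holder W_subset by blast

lemma Q_range: "0 \<le> Q k" "Q k \<le> 1"
  using Q_attained[of k] x_range[of _ k] by metis+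

lemma grid_gap:
  assumes "r = \<gamma> * of_int z" "r' = \<gamma> * of_int z'" "r < r'"
  shows "r + \<gamma> \<le> r'"
proof -
  have "z < z'" using assms mesh by simp
  then have "of_int (z + 1) \<le> (of_int z' :: real)" by linarith
  then have "\<gamma> * of_int (z + 1) \<le> \<gamma> * of_int z'" using mesh by simp
  then show ?thesis using assms by (simp add: algebra_simps)
qed

lemma Q_grid: "\<exists>z. Q k = \<gamma> * of_int z"
  using Q_attained grid by metis

lemma below_step:
  assumes "i < n" "x k i < Q k"
  shows "i \<in> W k" "x (Suc k) i = x k i + \<gamma>"
proof -
  show W: "i \<in> W k" using loser_ge assms by force
  have "x k i + \<gamma> \<le> Q k" using grid[OF assms(1)] Q_grid grid_gap assms(2) by metis
  then show "x (Suc k) i = x k i + \<gamma>" using winner_step[OF W] Q_range[of k] by simp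
qed

lemma above_step:
  assumes "i < n" "x k i > Q k"
  shows "i \<notin> W k" "x (Suc k) i = x k i - \<gamma>"
proof -
  show W: "i \<notin> W k" using winner_le assms by force
  have "Q k + \<gamma> \<le> x k i" using grid[OF assms(1)] Q_grid grid_gap assms(2) by metis
  then show "x (Suc k) i = x k i - \<gamma>" using loser_step[OF _ W] Q_range[of k] assms by simp
qed

lemma step_bound: "i < n \<Longrightarrow> \<bar>x (Suc k) i - x k i\<bar> \<le> \<gamma>"
  using winner_step[of i k] loser_step[of i k] x_range[of i k] mesh
  by (cases "i \<in> W k") (auto simp: min_def max_def)

lemma travel_bound: "i < n \<Longrightarrow> \<bar>x k i - x 0 i\<bar> \<le> real k * \<gamma>"
proof (induction k)
  case (Suc k)
  then show ?case using step_bound[of i k] by (simp add: algebra_simps)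
qed simp

lemma card_below: "card {i. i < n \<and> x k i < Q k} < m"
proof -
  obtain j where j: "j \<in> W k" "x k j = Q k" using holder by blast
  have "{i. i < n \<and> x k i < Q k} \<subseteq> W k" using below_step(1) by blast
  moreover have "j \<notin> {i. i < n \<and> x k i < Q k}" using j(2) by simp
  ultimately have "{i. i < n \<and> x k i < Q k} \<subset> W k" using j(1) by blast
  then show ?thesis using psubset_card_mono finite_W card_W by metis
qed

lemma Q_step: "\<bar>Q (Suc k) - Q k\<bar> \<le> \<gamma>"
proof -
  have "Q (Suc k) \<le> Q k + \<gamma>"
  proof (rule ccontr)
    assume "\<not> ?thesis"
    then have "W k \<subseteq> {i. i < n \<and> x (Suc k) i < Q (Suc k)}"
      using winner_le winner_step W_subset by fastforce
    then have "card (W k) \<le> card {i. i < n \<and> x (Suc k) i < Q (Suc k)}"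
      by (intro card_mono) auto
    then show False using card_below[of "Suc k"] card_W[of k] by simp
  qed
  moreover have "Q k - \<gamma> \<le> Q (Suc k)"
  proof (rule ccontr)
    assume neg: "\<not> ?thesis"
    have "W (Suc k) \<subseteq> {i. i < n \<and> x k i < Q k}"
    proof
      fix i assume i: "i \<in> W (Suc k)"
      then have "i < n" using W_subset by blast
      then show "i \<in> {i. i < n \<and> x k i < Q k}"
        using winner_le[OF i] step_bound[of i k] neg by auto
    qed
    then have "card (W (Suc k)) \<le> card {i. i < n \<and> x k i < Q k}"
      by (intro card_mono) auto
    then show False using card_below[of k] card_W[of "Suc k"] by simp
  qed
  ultimately show ?thesis by linarith
qed

lemma Q_travel: "\<bar>Q (s + d) - Q s\<bar> \<le> real d * \<gamma>"
proof (induction d)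
  case (Suc d)
  then show ?case using Q_step[of "s + d"] by (simp add: algebra_simps)
qed simp

lemma trichotomy:
  assumes "i < n"
  shows "x k i = x 0 i + real k * \<gamma> \<and> x k i < Q k \<or>
    x k i = x 0 i - real k * \<gamma> \<and> x k i > Q k \<or> \<bar>x k i - Q k\<bar> \<le> 2 * \<gamma>"
proof (induction k)
  case 0
  then show ?case using mesh by auto
next
  case (Suc k)
  have Q: "\<bar>Q (Suc k) - Q k\<bar> \<le> \<gamma>" by (rule Q_step)
  consider "x k i < Q k" | "x k i > Q k" | "x k i = Q k" by linarith
  then show ?case
  proof cases
    case 1
    then have "x (Suc k) i = x k i + \<gamma>" using below_step assms by blast
    with Suc 1 Q show ?thesis by (auto simp: algebra_simps)
  next
    case 2
    then have "x (Suc k) i = x k i - \<gamma>" using above_step assms by blast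
    with Suc 2 Q show ?thesis by (auto simp: algebra_simps)
  next
    case 3
    then show ?thesis using step_bound[OF assms, of k] Q by linarith
  qed
qed

lemma sum_votes:
  "(\<Sum>i<n. if i \<in> W k then c else - c) = (2 * real m - real n) * (c :: real)"
proof -
  have "(\<Sum>i<n. if i \<in> W k then c else - c) = (\<Sum>i\<in>W k. c) + (\<Sum>i\<in>{..<n} - W k. - c)"
    using W_subset[of k] by (subst sum.If_cases) (auto simp: Int_absorb1 Diff_eq Compl_eq)
  also have "card ({..<n} - W k) = n - m"
    using card_Diff_subset[OF finite_W W_subset] card_W by simp
  then have "(\<Sum>i\<in>W k. c) + (\<Sum>i\<in>{..<n} - W k. - c) = (2 * real m - real n) * c"
    using card_W m_le_n by (simp add: algebra_simps of_nat_diff)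
  finally show ?thesis .
qed

lemma sum_step_le:
  assumes "Q k > 0"
  shows "(\<Sum>i<n. x (Suc k) i) \<le> (\<Sum>i<n. x k i) + (2 * real m - real n) * \<gamma>"
proof -
  have "x (Suc k) i \<le> x k i + (if i \<in> W k then \<gamma> else - \<gamma>)" if "i < n" for i
  proof (cases "i \<in> W k")
    case False
    have "\<exists>z. x k i = \<gamma> * of_int z" "0 < x k i"
      using grid that loser_ge[OF that False] assms by auto
    then have "0 + \<gamma> \<le> x k i" using grid_gap[of 0 0] by force
    then show ?thesis using loser_step[OF that False] False by simp
  qed (simp add: winner_step)
  then have "(\<Sum>i<n. x (Suc k) i) \<le> (\<Sum>i<n. x k i + (if i \<in> W k then \<gamma> else - \<gamma>))"
    by (intro sum_mono) auto
  then show ?thesis by (simp only: sum.distrib sum_votes)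
qed

lemma sum_step_ge:
  assumes "Q k < 1"
  shows "(\<Sum>i<n. x k i) + (2 * real m - real n) * \<gamma> \<le> (\<Sum>i<n. x (Suc k) i)"
proof -
  have "x k i + (if i \<in> W k then \<gamma> else - \<gamma>) \<le> x (Suc k) i" if "i < n" for i
  proof (cases "i \<in> W k")
    case True
    have "\<exists>z. x k i = \<gamma> * of_int z" "x k i < 1" "1 = \<gamma> * of_int (int N)"
      using grid that winner_le[OF True] assms mesh by auto
    then have "x k i + \<gamma> \<le> 1" using grid_gap by metis
    then show ?thesis using winner_step[OF True] True by simp
  qed (simp add: loser_step that)
  then have "(\<Sum>i<n. x k i + (if i \<in> W k then \<gamma> else - \<gamma>)) \<le> (\<Sum>i<n. x (Suc k) i)"
    by (intro sum_mono) auto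
  then show ?thesis by (simp only: sum.distrib sum_votes)
qed

lemma sum_run_le:
  assumes "\<forall>j\<in>{s..<s + d}. Q j > 0"
  shows "(\<Sum>i<n. x (s + d) i) \<le> (\<Sum>i<n. x s i) + (2 * real m - real n) * (real d * \<gamma>)"
  using assms
proof (induction d)
  case (Suc d)
  then show ?case using sum_step_le[of "s + d"] by (simp add: algebra_simps)
qed simp

lemma sum_run_ge:
  assumes "\<forall>j\<in>{s..<s + d}. Q j < 1"
  shows "(\<Sum>i<n. x s i) + (2 * real m - real n) * (real d * \<gamma>) \<le> (\<Sum>i<n. x (s + d) i)"
  using assms
proof (induction d)
  case (Suc d)
  then show ?case using sum_step_ge[of "s + d"] by (simp add: algebra_simps)
qed simp

end

section \<open>The continuous evolution\<close>

lemma right_induct_le: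
  fixes f :: "real \<Rightarrow> real"
  assumes "a \<le> b" "continuous_on {a..b} f" "f a \<le> 0"
    and step: "\<And>t. a \<le> t \<Longrightarrow> t < b \<Longrightarrow> f t \<le> 0 \<Longrightarrow> \<forall>\<^sub>F h in at_right 0. f (t + h) \<le> 0"
  shows "f b \<le> 0"
proof (rule ccontr)
  assume neg: "\<not> f b \<le> 0"
  define A where "A = {s\<in>{a..b}. f s > 0}"
  define z where "z = Inf A"
  have A: "b \<in> A" "bdd_below A" using neg assms(1) by (auto simp: A_def intro: bdd_belowI)
  have "A \<noteq> {}" using A(1) by blast
  then have "a \<le> z" unfolding z_def by (rule cInf_greatest) (simp add: A_def)
  moreover have "z \<le> b" unfolding z_def by (rule cInf_lower[OF A])
  ultimately have z: "a \<le> z" "z \<le> b" by auto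
  have before: "f s \<le> 0" if "a \<le> s" "s < z" for s
  proof (rule ccontr)
    assume "\<not> ?thesis"
    then have "s \<in> A" using that z by (simp add: A_def)
    then show False using cInf_lower[OF _ A(2)] that(2) unfolding z_def by fastforce
  qed
  have fz: "f z \<le> 0"
  proof (cases "z = a")
    case False
    then have "a < z" using z by simp
    then have "(f \<longlongrightarrow> f z) (at_left z)"
      by (intro continuous_on_Icc_at_leftD[of a] continuous_on_subset[OF assms(2)]) (use z in auto)
    moreover have "\<forall>\<^sub>F s in at_left z. f s \<le> 0"
      by (rule eventually_mono[OF eventually_at_left_real[OF \<open>a < z\<close>]]) (use before in auto)
    ultimately show ?thesis by (intro tendsto_upperbound) auto
  qed (use assms in simp)
  then have "z < b" using neg z by (cases "z = b") auto
  then obtain e where e: "e > 0" "\<And>h. 0 < h \<Longrightarrow> h < e \<Longrightarrow> f (z + h) \<le> 0"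
    using step[OF z(1) _ fz] unfolding eventually_at_right_field by auto
  have "z + e \<le> s" if "s \<in> A" for s
  proof (rule ccontr)
    assume s: "\<not> ?thesis"
    have "z \<le> s" using cInf_lower[OF that A(2)] by (simp add: z_def)
    then consider "s = z" | "0 < s - z" by linarith
    then show False
    proof cases
      case 2
      then show False using e(2)[of "s - z"] s that by (simp add: A_def)
    qed (use fz that in \<open>simp add: A_def\<close>)
  qed
  then have "z + e \<le> z" using cInf_greatest[of A "z + e"] A(1) unfolding z_def by blast
  then show False using e by simp
qed

lemma max_price_local:
  assumes mp: "max_price p B q" and t: "0 \<le> t" and range: "q t \<in> {0..1}"
  defines "u \<equiv> drift p B q t"
  defines "c \<equiv> if q t = 0 then max 0 u else if q t = 1 then min 0 u else u"
  shows "\<forall>\<^sub>F h in at_right 0. q (t + h) = q t + c * h"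
proof -
  from mp obtain S where S: "\<And>T. finite (S \<inter> {0..T})"
    and aff: "\<And>a b. 0 \<le> a \<Longrightarrow> {a<..<b} \<inter> S = {} \<Longrightarrow>
        (\<exists>c d. \<forall>t\<in>{a<..<b}. q t = c * t + d) \<and> (\<exists>v. \<forall>t\<in>{a<..<b}. drift p B q t = v)"
    and ode: "\<And>t. t > 0 \<Longrightarrow> t \<notin> S \<Longrightarrow>
        (q has_real_derivative drift p B q t * of_bool (q t \<in> {0<..<1})) (at t)"
    unfolding max_price_def by blast
  from mp have cont: "continuous_on {0..} q" and rc: "continuous (at_right t) (drift p B q)"
    and ends: "\<And>s. s > 0 \<Longrightarrow> (q s = 0 \<longrightarrow> drift p B q s \<le> 0) \<and> (q s = 1 \<longrightarrow> drift p B q s \<ge> 0)"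
    using t unfolding max_price_def by blast+
  obtain e where e: "e > t" "{t<..<e} \<inter> S = {}"
  proof (cases "S \<inter> {t<..t + 1} = {}")
    case True
    then show ?thesis by (intro that[of "t + 1"]) auto
  next
    case False
    have fin: "finite (S \<inter> {t<..t + 1})"
      by (rule finite_subset[OF _ S[of "t + 1"]]) (use t in auto)
    define e where "e = Min (S \<inter> {t<..t + 1})"
    have "e \<in> S \<inter> {t<..t + 1}" unfolding e_def by (rule Min_in[OF fin False])
    moreover have "s \<notin> S \<inter> {t<..t + 1}" if "s < e" for s
      using Min_le[OF fin, of s] that unfolding e_def by linarith
    ultimately show ?thesis by (intro that[of e]) (auto simp: disjoint_iff)
  qed
  obtain c' d v where q: "\<And>s. s \<in> {t<..<e} \<Longrightarrow> q s = c' * s + d"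
    and v: "\<And>s. s \<in> {t<..<e} \<Longrightarrow> drift p B q s = v"
    using aff[OF t e(2)] by blast
  have near: "\<forall>\<^sub>F s in at_right t. s \<in> {t<..<e}"
    by (rule eventually_at_right_real) (use e(1) in simp)
  have uv: "u = v"
  proof (rule tendsto_unique[of "at_right t"])
    show "(drift p B q \<longlongrightarrow> u) (at_right t)"
      using rc unfolding continuous_within u_def .
    show "(drift p B q \<longlongrightarrow> v) (at_right t)"
      by (rule tendsto_eventually) (use near v in \<open>auto elim: eventually_mono\<close>)
  qed simp
  have qt: "q t = c' * t + d"
  proof (rule tendsto_unique[of "at_right t"])
    show "(q \<longlongrightarrow> q t) (at_right t)"
      using cont t by (auto simp: continuous_on_def intro: tendsto_within_subset)
    have "((\<lambda>s. c' * s + d) \<longlongrightarrow> c' * t + d) (at_right t)" by (intro tendsto_intros)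
    then show "(q \<longlongrightarrow> c' * t + d) (at_right t)"
      by (rule Lim_transform_eventually) (use near q in \<open>auto elim: eventually_mono\<close>)
  qed simp
  have slope: "c' = u * of_bool (q s \<in> {0<..<1})" if s: "s \<in> {t<..<e}" for s
  proof -
    have "((\<lambda>s. c' * s + d) has_real_derivative c') (at s)"
      by (auto intro!: derivative_eq_intros)
    then have "(q has_real_derivative c') (at s)"
      by (rule has_field_derivative_transform_within_open[of _ _ _ "{t<..<e}"]) (use s q in auto)
    moreover have "(q has_real_derivative v * of_bool (q s \<in> {0<..<1})) (at s)"
      using ode[of s] s e(2) t v[OF s] by (auto simp: disjoint_iff)
    ultimately show ?thesis unfolding uv by (rule DERIV_unique)
  qed
  define h0 where "h0 = min ((e - t) / 2) (1 / (2 * (1 + \<bar>c'\<bar>)))"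
  have h0: "h0 > 0" "t + h0 \<in> {t<..<e}" "\<bar>c' * h0\<bar> < 1"
  proof -
    show h: "h0 > 0" using e(1) by (simp add: h0_def)
    show "t + h0 \<in> {t<..<e}" using e(1) h by (auto simp: h0_def min_def field_simps)
    have "\<bar>c'\<bar> * h0 \<le> \<bar>c'\<bar> * (1 / (2 * (1 + \<bar>c'\<bar>)))"
      by (intro mult_left_mono) (auto simp: h0_def)
    also have "\<dots> < 1" by (simp add: field_simps)
    finally show "\<bar>c' * h0\<bar> < 1" using h by (simp add: abs_mult)
  qed
  have qh: "q (t + h) = q t + c' * h" if "0 < h" "t + h < e" for h
    using q[of "t + h"] qt that by (simp add: algebra_simps)
  have s0: "q (t + h0) = q t + c' * h0" using qh h0 by simp
  have sl0: "c' = u * of_bool (q (t + h0) \<in> {0<..<1})" using slope h0 by blast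
  have out: "c' = 0" if "q (t + h0) \<le> 0 \<or> q (t + h0) \<ge> 1"
    using that by (subst sl0) auto
  have inside: "c' = u" if "0 < q (t + h0)" "q (t + h0) < 1"
    using that by (subst sl0) auto
  have e0: "q (t + h0) = 0 \<Longrightarrow> u \<le> 0" "q (t + h0) = 1 \<Longrightarrow> u \<ge> 0"
    using ends[of "t + h0"] v[OF h0(2)] uv t h0 by auto
  have small: "- 1 < c' * h0" "c' * h0 < 1" using h0(3) by auto
  consider "q t = 0" | "q t = 1" | "0 < q t" "q t < 1" using range by (auto simp: less_le)
  then have "c' = c"
  proof cases
    case 1
    have "c' \<ge> 0"
    proof (rule ccontr)
      assume "\<not> ?thesis"
      then have "c' * h0 < 0" using h0 by (simp add: mult_neg_pos)
      then have "c' = 0" using out s0 1 by linarith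
      with \<open>c' * h0 < 0\<close> show False by simp
    qed
    then consider "c' = 0" | "c' > 0" "c' * h0 > 0" using h0 by (metis mult_pos_pos order_le_less)
    then show ?thesis
    proof cases
      case 1
      then show ?thesis using e0 s0 \<open>q t = 0\<close> by (simp add: c_def)
    next
      case 2
      then have "c' = u" using inside s0 \<open>q t = 0\<close> small by linarith
      with 2 show ?thesis using \<open>q t = 0\<close> by (simp add: c_def)
    qed
  next
    case 2
    have "c' \<le> 0"
    proof (rule ccontr)
      assume "\<not> ?thesis"
      then have "c' * h0 > 0" using h0 by simp
      then have "c' = 0" using out s0 2 by linarith
      with \<open>c' * h0 > 0\<close> show False by simp
    qed
    then consider "c' = 0" | "c' < 0" "c' * h0 < 0" using h0 by (metis mult_neg_pos order_le_less)
    then show ?thesis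
    proof cases
      case 1
      then show ?thesis using e0 s0 \<open>q t = 1\<close> by (simp add: c_def)
    next
      case 2
      then have "c' = u" using inside s0 \<open>q t = 1\<close> small by linarith
      with 2 show ?thesis using \<open>q t = 1\<close> by (simp add: c_def)
    qed
  next
    case 3
    have "((\<lambda>h. q t + c' * h) \<longlongrightarrow> q t + c' * 0) (at_right 0)" by (intro tendsto_intros)
    then have "\<forall>\<^sub>F h in at_right 0. q t + c' * h \<in> {0<..<1}"
      by (rule topological_tendstoD) (use 3 in auto)
    moreover have "\<forall>\<^sub>F h in at_right 0. h \<in> {0<..<e - t}"
      by (rule eventually_at_right_real) (use e(1) in simp)
    ultimately have "\<forall>\<^sub>F h in at_right 0. q t + c' * h \<in> {0<..<1} \<and> h \<in> {0<..<e - t}"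
      by (rule eventually_conj)
    then obtain h where h: "q t + c' * h \<in> {0<..<1}" "h \<in> {0<..<e - t}"
      using eventually_happens trivial_limit_at_right_real by blast
    then have "q (t + h) \<in> {0<..<1}" using qh[of h] by simp
    moreover have "t + h \<in> {t<..<e}" using h(2) by auto
    ultimately have "c' = u" using slope by fastforce
    then show ?thesis using 3 by (simp add: c_def)
  qed
  moreover have "\<forall>\<^sub>F h in at_right 0. h \<in> {0<..<e - t}"
    by (rule eventually_at_right_real) (use e(1) in simp)
  ultimately show ?thesis using qh by (auto elim: eventually_mono)
qed

lemma eventually_line_less: "(a::real) < d \<Longrightarrow> \<forall>\<^sub>F h in at_right 0. a + v * h < d"
proof -
  assume "a < d"
  moreover have "((\<lambda>h. a + v * h) \<longlongrightarrow> a + v * 0) (at_right 0)" by (intro tendsto_intros)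
  ultimately show ?thesis using order_tendstoD(2)[of _ "a + v * 0"] by simp
qed

lemma eventually_pos: "\<forall>\<^sub>F h in at_right 0. (0::real) < h"
  by (simp add: eventually_at_right_less)

lemma eventually_before: "(r::real) < t \<Longrightarrow> \<forall>\<^sub>F h in at_right 0. r + h < t"
  using eventually_line_less[of r t 1] by simp

text \<open>\<open>u\<close> is the drift and \<open>c\<close> the actual right derivative of \<open>q\<close>; they differ only while \<open>q\<close> is
  held at an endpoint.\<close>

locale continuous_auction =
  fixes n m :: nat and b :: "nat \<Rightarrow> real" and q u c :: "real \<Rightarrow> real"
  assumes b_sorted: "\<And>i j. i \<le> j \<Longrightarrow> j < n \<Longrightarrow> b i \<le> b j"
    and b_range: "\<And>i. i < n \<Longrightarrow> 0 \<le> b i \<and> b i \<le> 1"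
    and m_bounds: "1 \<le> m" "m \<le> n"
    and q_0: "q 0 = b (m - 1)"
    and q_cont: "continuous_on {0..} q"
    and q_local: "\<And>t. 0 \<le> t \<Longrightarrow> q t \<in> {0..1} \<Longrightarrow> \<forall>\<^sub>F h in at_right 0. q (t + h) = q t + c t * h"
    and c_eq: "\<And>t. c t = (if q t = 0 then max 0 (u t) else if q t = 1 then min 0 (u t) else u t)"
    and u_ends: "\<And>t. t > 0 \<Longrightarrow> (q t = 0 \<longrightarrow> u t \<le> 0) \<and> (q t = 1 \<longrightarrow> u t \<ge> 0)"
    and u_eq: "\<And>t. u t =
      (2 * real m - real n - real (card {i. i < n \<and> b i < q t - t}) + real (card {i. i < n \<and> q t + t < b i}))
      / (real n - real (card {i. i < n \<and> b i < q t - t}) - real (card {i. i < n \<and> q t + t < b i}))"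
begin

definition below :: "real \<Rightarrow> nat set" where "below t = {i. i < n \<and> b i < q t - t}"
definition above :: "real \<Rightarrow> nat set" where "above t = {i. i < n \<and> q t + t < b i}"
definition stuck :: "real \<Rightarrow> real" where
  "stuck t = real n - real (card (below t)) - real (card (above t))"

lemma q_cont_Icc: "0 \<le> s \<Longrightarrow> continuous_on {s..t} q"
  by (rule continuous_on_subset[OF q_cont]) auto

lemma q_range:
  assumes "0 \<le> t"
  shows "0 \<le> q t" "q t \<le> 1"
proof -
  have "max (- q t) (q t - 1) \<le> 0"
  proof (rule right_induct_le[OF assms])
    show "continuous_on {0..t} (\<lambda>r. max (- q r) (q r - 1))"
      by (intro continuous_intros q_cont_Icc) simp_all
    show "max (- q 0) (q 0 - 1) \<le> 0" using b_range[of "m - 1"] m_bounds unfolding q_0 by simp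
  next
    fix r assume r: "0 \<le> r" "max (- q r) (q r - 1) \<le> 0"
    have "\<forall>\<^sub>F h in at_right 0. q r + c r * h \<le> 1"
    proof (cases "q r = 1")
      case True
      then have "c r \<le> 0" using c_eq by simp
      show ?thesis using eventually_pos
        by eventually_elim (use True \<open>c r \<le> 0\<close> in \<open>simp add: mult_nonpos_nonneg\<close>)
    next
      case False
      then have "\<forall>\<^sub>F h in at_right 0. q r + c r * h < 1"
        by (intro eventually_line_less) (use r in auto)
      then show ?thesis by (auto elim: eventually_mono)
    qed
    moreover have "\<forall>\<^sub>F h in at_right 0. - q r + - c r * h \<le> 0"
    proof (cases "q r = 0")
      case True
      then have "0 \<le> c r" using c_eq by simp
      show ?thesis using eventually_pos
        by eventually_elim (use True \<open>0 \<le> c r\<close> in simp)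
    next
      case False
      then have "\<forall>\<^sub>F h in at_right 0. - q r + - c r * h < 0"
        by (intro eventually_line_less) (use r in auto)
      then show ?thesis by (auto elim: eventually_mono)
    qed
    moreover have "\<forall>\<^sub>F h in at_right 0. q (r + h) = q r + c r * h"
      by (rule q_local) (use r in auto)
    ultimately show "\<forall>\<^sub>F h in at_right 0. max (- q (r + h)) (q (r + h) - 1) \<le> 0"
      by eventually_elim simp
  qed
  then show "0 \<le> q t" "q t \<le> 1" by auto
qed

lemma q_line: "0 \<le> t \<Longrightarrow> \<forall>\<^sub>F h in at_right 0. q (t + h) = q t + c t * h"
  by (rule q_local) (use q_range in auto)

lemma u_balance:
  assumes "\<bar>q t - b (m - 1)\<bar> \<le> t"
  shows "stuck t > 0"
    and "stuck t * u t = 2 * real m - real n - real (card (below t)) + real (card (above t))"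
    and "\<bar>c t\<bar> \<le> 1"
proof -
  have "i < m - 1" if i: "i \<in> below t" for i
  proof -
    have "b i < b (m - 1)" "i < n" using i assms unfolding below_def by auto
    then show ?thesis using b_sorted[of "m - 1" i] by linarith
  qed
  then have "below t \<subseteq> {..<m - 1}" by auto
  then have B: "card (below t) \<le> m - 1" using card_mono[of "{..<m - 1}"] by simp
  have "m \<le> i \<and> i < n" if i: "i \<in> above t" for i
  proof -
    have "b (m - 1) < b i" using i assms unfolding above_def by auto
    then have "\<not> i \<le> m - 1" using b_sorted[of i "m - 1"] m_bounds by linarith
    then show ?thesis using i unfolding above_def by auto
  qed
  then have "above t \<subseteq> {m..<n}" by auto
  then have A: "card (above t) \<le> n - m" using card_mono[of "{m..<n}"] by simp
  have le: "real (card (below t)) + 1 \<le> real m" "real (card (above t)) + real m \<le> real n"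
    using A B m_bounds by linarith+
  then show pos: "stuck t > 0" unfolding stuck_def by linarith
  have u: "u t = (2 * real m - real n - real (card (below t)) + real (card (above t))) / stuck t"
    using u_eq[of t] unfolding below_def above_def stuck_def .
  then show "stuck t * u t = 2 * real m - real n - real (card (below t)) + real (card (above t))"
    using pos by simp
  have "\<bar>u t\<bar> \<le> 1"
    unfolding u using pos le by (auto simp: abs_le_iff field_simps stuck_def)
  then show "\<bar>c t\<bar> \<le> 1" using c_eq[of t] by auto
qed

lemma q_near_start:
  assumes "0 \<le> t"
  shows "\<bar>q t - b (m - 1)\<bar> \<le> t"
proof -
  have "\<bar>q t - b (m - 1)\<bar> - t \<le> 0"
  proof (rule right_induct_le[OF assms])
    show "continuous_on {0..t} (\<lambda>r. \<bar>q r - b (m - 1)\<bar> - r)"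
      by (intro continuous_intros q_cont_Icc) simp_all
    show "\<bar>q 0 - b (m - 1)\<bar> - 0 \<le> 0" using q_0 by simp
  next
    fix r assume r: "0 \<le> r" "\<bar>q r - b (m - 1)\<bar> - r \<le> 0"
    then have c: "\<bar>c r\<bar> \<le> 1" using u_balance(3) by simp
    show "\<forall>\<^sub>F h in at_right 0. \<bar>q (r + h) - b (m - 1)\<bar> - (r + h) \<le> 0"
      using q_line[OF r(1)] eventually_pos
    proof eventually_elim
      case (elim h)
      then have "\<bar>c r * h\<bar> \<le> h" using mult_right_mono[OF c, of h] by (simp add: abs_mult)
      then show ?case using elim r by linarith
    qed
  qed
  then show ?thesis by simp
qed

lemma speed_bound: "0 \<le> t \<Longrightarrow> \<bar>c t\<bar> \<le> 1"
  using u_balance(3) q_near_start by blast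

lemma q_lipschitz:
  assumes "0 \<le> s" "s \<le> t"
  shows "\<bar>q t - q s\<bar> \<le> t - s"
proof -
  have "\<bar>q t - q s\<bar> - (t - s) \<le> 0"
  proof (rule right_induct_le[OF assms(2)])
    show "continuous_on {s..t} (\<lambda>r. \<bar>q r - q s\<bar> - (r - s))"
      by (intro continuous_intros q_cont_Icc assms)
  next
    fix r assume r: "s \<le> r" "\<bar>q r - q s\<bar> - (r - s) \<le> 0"
    have r0: "0 \<le> r" using r assms by simp
    show "\<forall>\<^sub>F h in at_right 0. \<bar>q (r + h) - q s\<bar> - (r + h - s) \<le> 0"
      using q_line[OF r0] eventually_pos
    proof eventually_elim
      case (elim h)
      then have "\<bar>c r * h\<bar> \<le> h"
        using mult_right_mono[OF speed_bound[OF r0], of h] by (simp add: abs_mult)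
      then show ?case using elim r by linarith
    qed
  qed simp
  then show ?thesis by simp
qed

lemma absorbed_at_1:
  assumes "0 < s" "s \<le> t" "q s = 1"
  shows "q t = 1"
proof -
  have "1 - q t \<le> 0"
  proof (rule right_induct_le[OF assms(2)])
    show "continuous_on {s..t} (\<lambda>r. 1 - q r)"
      by (intro continuous_intros q_cont_Icc) (use assms in simp_all)
  next
    fix r assume r: "s \<le> r" "1 - q r \<le> 0"
    then have q: "q r = 1" using q_range[of r] assms by simp
    then have "c r = 0" using u_ends[of r] c_eq[of r] r assms by simp
    then show "\<forall>\<^sub>F h in at_right 0. 1 - q (r + h) \<le> 0"
      using q_line[of r] q r assms by (auto elim: eventually_mono)
  qed (use assms in simp)
  then show ?thesis using q_range[of t] assms by simp
qed

lemma absorbed_at_0: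
  assumes "0 < s" "s \<le> t" "q s = 0"
  shows "q t = 0"
proof -
  have "q t \<le> 0"
  proof (rule right_induct_le[OF assms(2)])
    show "continuous_on {s..t} q" by (intro q_cont_Icc) (use assms in simp)
  next
    fix r assume r: "s \<le> r" "q r \<le> 0"
    then have q: "q r = 0" using q_range[of r] assms by simp
    then have "c r = 0" using u_ends[of r] c_eq[of r] r assms by simp
    then show "\<forall>\<^sub>F h in at_right 0. q (r + h) \<le> 0"
      using q_line[of r] q r assms by (auto elim: eventually_mono)
  qed (use assms in simp)
  then show ?thesis using q_range[of t] assms by simp
qed

text \<open>Constant while \<open>0 < q < 1\<close>; only an endpoint holding \<open>q\<close> changes it.\<close>

definition excess :: "real \<Rightarrow> real" where
  "excess t = (\<Sum>i<n. clamp (b i) t (q t)) - (2 * real m - real n) * t"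

lemma excess_cont: "0 \<le> s \<Longrightarrow> continuous_on {s..t} excess"
  unfolding excess_def clamp_def by (intro continuous_intros q_cont_Icc)

lemma excess_0: "excess 0 = (\<Sum>i<n. b i)"
  by (simp add: excess_def clamp_def)

lemma clamp_local:
  assumes "0 \<le> t" "i < n"
  shows "\<forall>\<^sub>F h in at_right 0. clamp (b i) (t + h) (q (t + h)) = clamp (b i) t (q t)
    + h * (if i \<in> below t then 1 else if i \<in> above t then - 1 else c t)"
proof -
  consider "i \<in> below t" | "i \<in> above t" | "i \<notin> below t" "i \<notin> above t" by blast
  then show ?thesis
  proof cases
    case 1
    then have "\<forall>\<^sub>F h in at_right 0. t - q t + (1 - c t) * h < - b i"
      by (intro eventually_line_less) (simp add: below_def)
    then show ?thesis using q_line[OF assms(1)] eventually_pos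
    proof eventually_elim
      case (elim h)
      have "b i < q (t + h) - (t + h)" using elim by (simp add: algebra_simps)
      then show ?case using 1 elim assms by (simp add: clamp_def below_def)
    qed
  next
    case 2
    then have "\<forall>\<^sub>F h in at_right 0. t + q t + (1 + c t) * h < b i"
      by (intro eventually_line_less) (simp add: above_def)
    then show ?thesis using q_line[OF assms(1)] eventually_pos
    proof eventually_elim
      case (elim h)
      have "q (t + h) + (t + h) < b i" using elim by (simp add: algebra_simps)
      then show ?case using 2 elim assms by (auto simp: clamp_def above_def below_def)
    qed
  next
    case 3
    show ?thesis using q_line[OF assms(1)] eventually_pos
    proof eventually_elim
      case (elim h)
      then have "\<bar>c t * h\<bar> \<le> h"
        using mult_right_mono[OF speed_bound[OF assms(1)], of h] by (simp add: abs_mult)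
      then show ?case using 3 elim assms by (auto simp: clamp_def above_def below_def)
    qed
  qed
qed

lemma excess_local:
  assumes "0 \<le> t"
  shows "\<forall>\<^sub>F h in at_right 0. excess (t + h) = excess t + h * (stuck t * (c t - u t))"
proof -
  have clamps: "\<forall>\<^sub>F h in at_right 0. \<forall>i\<in>{..<n}. clamp (b i) (t + h) (q (t + h)) = clamp (b i) t (q t)
    + h * (if i \<in> below t then 1 else if i \<in> above t then - 1 else c t)"
    by (intro eventually_ball_finite ballI clamp_local) (use assms in auto)
  have total: "(\<Sum>i<n. if i \<in> below t then 1 else if i \<in> above t then - 1 else c t)
    = real (card (below t)) - real (card (above t)) + stuck t * c t"
  proof -
    have "(if i \<in> below t then 1 else if i \<in> above t then - 1 else c t)
      = c t + of_bool (i \<in> below t) * (1 - c t) + of_bool (i \<in> above t) * (- 1 - c t)" for i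
      by (auto simp: below_def above_def) (use assms in linarith)
    then have "(\<Sum>i<n. if i \<in> below t then 1 else if i \<in> above t then - 1 else c t)
      = (\<Sum>i<n. c t) + (\<Sum>i<n. of_bool (i \<in> below t)) * (1 - c t)
        + (\<Sum>i<n. of_bool (i \<in> above t)) * (- 1 - c t)"
      by (simp only: sum.distrib sum_distrib_right)
    moreover have "(\<Sum>i<n. of_bool (i \<in> below t)) = real (card (below t))"
      "(\<Sum>i<n. of_bool (i \<in> above t)) = real (card (above t))"
      by (auto simp: of_bool_def sum.If_cases below_def above_def intro!: arg_cong[of _ _ card])
    ultimately show ?thesis by (simp add: stuck_def algebra_simps)
  qed
  have balance: "stuck t * (c t - u t) = stuck t * c t
    - (2 * real m - real n - real (card (below t)) + real (card (above t)))"
    using u_balance(2)[OF q_near_start[OF assms]] by (simp add: algebra_simps)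
  show ?thesis
    using clamps
  proof eventually_elim
    case (elim h)
    have "(\<Sum>i<n. clamp (b i) (t + h) (q (t + h))) = (\<Sum>i<n. clamp (b i) t (q t)
      + h * (if i \<in> below t then 1 else if i \<in> above t then - 1 else c t))"
      by (rule sum.cong) (use elim in auto)
    also have "\<dots> = (\<Sum>i<n. clamp (b i) t (q t))
      + h * (real (card (below t)) - real (card (above t)) + stuck t * c t)"
      by (simp only: sum.distrib sum_distrib_left[symmetric] total)
    finally show ?case
      unfolding balance excess_def by (simp add: algebra_simps)
  qed
qed

lemma excess_mono:
  assumes "0 \<le> s" "s \<le> t" "q t < 1"
  shows "excess s \<le> excess t"
proof -
  have "excess s - excess t \<le> 0"
  proof (rule right_induct_le[OF assms(2)])
    show "continuous_on {s..t} (\<lambda>r. excess s - excess r)"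
      by (intro continuous_intros excess_cont assms)
  next
    fix r assume r: "s \<le> r" "r < t" "excess s - excess r \<le> 0"
    have r0: "0 \<le> r" using r assms by simp
    have "u r \<le> c r"
    proof (rule ccontr)
      assume "\<not> ?thesis"
      then have q: "q r = 1" and c: "c r = 0" using c_eq[of r] by (auto split: if_splits)
      have "\<forall>\<^sub>F h in at_right 0. q (r + h) = 1 \<and> 0 < h \<and> r + h < t"
        using q_line[OF r0] eventually_pos eventually_before[OF r(2)]
        by eventually_elim (use q c in simp)
      then obtain h where "q (r + h) = 1" "0 < h" "r + h < t"
        using eventually_happens trivial_limit_at_right_real by blast
      then show False using absorbed_at_1[of "r + h" t] assms r0 by simp
    qed
    then have pos: "0 \<le> stuck r * (c r - u r)"
      using u_balance(1)[OF q_near_start[OF r0]] by simp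
    show "\<forall>\<^sub>F h in at_right 0. excess s - excess (r + h) \<le> 0"
      using excess_local[OF r0] eventually_pos
    proof eventually_elim
      case (elim h)
      then have "0 \<le> h * (stuck r * (c r - u r))" using pos by simp
      then show ?case using elim r by linarith
    qed
  qed simp
  then show ?thesis by simp
qed

lemma excess_antimono:
  assumes "0 \<le> s" "s \<le> t" "q t > 0"
  shows "excess t \<le> excess s"
proof -
  have "excess t - excess s \<le> 0"
  proof (rule right_induct_le[OF assms(2)])
    show "continuous_on {s..t} (\<lambda>r. excess r - excess s)"
      by (intro continuous_intros excess_cont assms)
  next
    fix r assume r: "s \<le> r" "r < t" "excess r - excess s \<le> 0"
    have r0: "0 \<le> r" using r assms by simp
    have "c r \<le> u r"
    proof (rule ccontr)
      assume "\<not> ?thesis"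
      then have q: "q r = 0" and c: "c r = 0" using c_eq[of r] by (auto split: if_splits)
      have "\<forall>\<^sub>F h in at_right 0. q (r + h) = 0 \<and> 0 < h \<and> r + h < t"
        using q_line[OF r0] eventually_pos eventually_before[OF r(2)]
        by eventually_elim (use q c in simp)
      then obtain h where "q (r + h) = 0" "0 < h" "r + h < t"
        using eventually_happens trivial_limit_at_right_real by blast
      then show False using absorbed_at_0[of "r + h" t] assms r0 by simp
    qed
    then have neg: "stuck r * (c r - u r) \<le> 0"
      using u_balance(1)[OF q_near_start[OF r0]] by (simp add: mult_nonneg_nonpos)
    show "\<forall>\<^sub>F h in at_right 0. excess (r + h) - excess s \<le> 0"
      using excess_local[OF r0] eventually_pos
    proof eventually_elim
      case (elim h)
      then have "h * (stuck r * (c r - u r)) \<le> 0" using neg by (simp add: mult_nonneg_nonpos)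
      then show ?case using elim r by linarith
    qed
  qed simp
  then show ?thesis by simp
qed

end

section \<open>Comparison of the two evolutions\<close>

lemma sum_if_card:
  fixes n :: nat
  shows "(\<Sum>i<n. if P i then e else (0::real)) = real (card {i. i < n \<and> P i}) * e"
proof -
  have "{..<n} \<inter> {i. P i} = {i. i < n \<and> P i}" by auto
  then show ?thesis by (simp add: sum.If_cases)
qed

lemma last_time:
  assumes "\<not> (\<forall>j\<in>{0..<k}. P j)"
  obtains s where "s < k" "\<not> P s" "\<forall>j\<in>{Suc s..<k}. P j"
  using assms
proof (induction k arbitrary: thesis)
  case (Suc k)
  show ?case
  proof (cases "P k")
    case True
    then have "\<not> (\<forall>j\<in>{0..<k}. P j)" using Suc.prems(2) by (auto simp: less_Suc_eq)
    then obtain s where "s < k" "\<not> P s" "\<forall>j\<in>{Suc s..<k}. P j" using Suc.IH by blast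
    then show ?thesis using True by (intro Suc.prems(1)[of s]) (auto simp: less_Suc_eq)
  qed (use Suc.prems(1)[of k] in simp)
qed simp

locale discrete_vs_continuous =
  discrete_bids \<gamma> N n m x Q W + continuous_auction n m b q u c
  for \<gamma> N n m x Q W b q u c +
  assumes discretized: "\<And>i. i < n \<Longrightarrow> x 0 i \<le> b i \<and> b i < x 0 i + \<gamma>"
    and Q_0: "Q 0 = x 0 (m - 1)"
begin

text \<open>Starting each discrete trajectory at the undiscretized bid keeps the rounding errors from
  adding up over the \<open>n\<close> bids in the upper bound.\<close>

definition shifted :: "nat \<Rightarrow> nat \<Rightarrow> real" where "shifted k i = x k i + (b i - x 0 i)"

lemma shifted_0: "shifted 0 i = b i"
  by (simp add: shifted_def)

lemma m_real: "1 \<le> real m" "real m \<le> real n"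
  using m_pos m_le_n by auto

lemma sum_shifted: "(\<Sum>i<n. shifted k i) = (\<Sum>i<n. x k i) + (\<Sum>i<n. b i - x 0 i)"
  by (simp add: shifted_def sum.distrib)

lemma bid_error:
  assumes "i < n"
  shows "\<bar>x k i - clamp (b i) (real k * \<gamma>) (Q k)\<bar> \<le> 2 * \<gamma>"
  using trichotomy[OF assms, of k] travel_bound[OF assms, of k] discretized[OF assms] mesh
  unfolding clamp_def by linarith

lemma clamp_Q_le_shifted:
  assumes "i < n"
  shows "clamp (b i) (real k * \<gamma>) (Q k) \<le> shifted k i + (if x k i < Q k then 2 * \<gamma> else 0)"
  using trichotomy[OF assms, of k] travel_bound[OF assms, of k] discretized[OF assms] mesh
  unfolding clamp_def shifted_def by (cases "x k i < Q k") (simp_all, linarith+)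

lemma shifted_le_clamp_Q:
  assumes "i < n"
  shows "shifted k i \<le> clamp (b i) (real k * \<gamma>) (Q k) + \<gamma> + (if x k i > Q k then 2 * \<gamma> else 0)"
  using trichotomy[OF assms, of k] travel_bound[OF assms, of k] discretized[OF assms] mesh
  unfolding clamp_def shifted_def by (cases "x k i > Q k") (simp_all, linarith+)

lemma card_above_le: "card {i. i < n \<and> Q k < x k i} \<le> n - m"
proof -
  have "{i. i < n \<and> Q k < x k i} \<subseteq> {..<n} - W k" using above_step(1) by blast
  then have "card {i. i < n \<and> Q k < x k i} \<le> card ({..<n} - W k)" by (intro card_mono) auto
  then show ?thesis using card_Diff_subset[OF finite_W W_subset] card_W by simp
qed

lemma sum_clamp_Q_le_shifted:
  "(\<Sum>i<n. clamp (b i) (real k * \<gamma>) (Q k)) \<le> (\<Sum>i<n. shifted k i) + 2 * (real m - 1) * \<gamma>"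
proof -
  have "(\<Sum>i<n. clamp (b i) (real k * \<gamma>) (Q k)) \<le> (\<Sum>i<n. shifted k i + (if x k i < Q k then 2 * \<gamma> else 0))"
    by (intro sum_mono clamp_Q_le_shifted) simp
  also have "\<dots> = (\<Sum>i<n. shifted k i) + real (card {i. i < n \<and> x k i < Q k}) * (2 * \<gamma>)"
    by (simp only: sum.distrib sum_if_card)
  also have "real (card {i. i < n \<and> x k i < Q k}) * (2 * \<gamma>) \<le> (real m - 1) * (2 * \<gamma>)"
    by (intro mult_right_mono) (use card_below[of k] mesh in linarith)+
  finally show ?thesis by (simp add: algebra_simps)
qed

lemma sum_shifted_le_clamp_Q:
  "(\<Sum>i<n. shifted k i) \<le> (\<Sum>i<n. clamp (b i) (real k * \<gamma>) (Q k)) + (3 * real n - 2 * real m) * \<gamma>"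
proof -
  have "(\<Sum>i<n. shifted k i) \<le> (\<Sum>i<n. clamp (b i) (real k * \<gamma>) (Q k) + \<gamma> + (if x k i > Q k then 2 * \<gamma> else 0))"
    by (intro sum_mono shifted_le_clamp_Q) simp
  also have "\<dots> = (\<Sum>i<n. clamp (b i) (real k * \<gamma>) (Q k)) + real n * \<gamma>
      + real (card {i. i < n \<and> x k i > Q k}) * (2 * \<gamma>)"
    by (simp only: sum.distrib sum_if_card) simp
  also have "real (card {i. i < n \<and> x k i > Q k}) * (2 * \<gamma>) \<le> (real n - real m) * (2 * \<gamma>)"
    by (intro mult_right_mono) (use card_above_le[of k] m_le_n mesh in linarith)+
  finally show ?thesis by (simp add: algebra_simps)
qed

lemma sum_clamp_gap:
  assumes "A \<subseteq> {..<n}" "r \<le> r'"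
    and "\<And>i. i \<in> A \<Longrightarrow> g \<le> clamp (b i) t r' - clamp (b i) t r"
  shows "real (card A) * g \<le> (\<Sum>i<n. clamp (b i) t r') - (\<Sum>i<n. clamp (b i) t r)"
proof -
  have "real (card A) * g = (\<Sum>i\<in>A. g)" by simp
  also have "\<dots> \<le> (\<Sum>i\<in>A. clamp (b i) t r' - clamp (b i) t r)"
    by (intro sum_mono assms)
  also have "\<dots> \<le> (\<Sum>i<n. clamp (b i) t r' - clamp (b i) t r)"
    using assms(1) clamp_mono[OF assms(2)] by (intro sum_mono2) auto
  finally show ?thesis by (simp add: sum_subtractf)
qed

lemma price_excess_restart:
  assumes "s \<le> k" "\<forall>j\<in>{s..<k}. Q j > 0" "q (real k * \<gamma>) < Q k"
    and "(\<Sum>i<n. shifted s i) \<le> (\<Sum>i<n. clamp (b i) (real s * \<gamma>) (q (real s * \<gamma>))) + C"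
    and "A \<subseteq> {..<n}"
    and "\<And>i. i \<in> A \<Longrightarrow> Q k - q (real k * \<gamma>)
      \<le> clamp (b i) (real k * \<gamma>) (Q k) - clamp (b i) (real k * \<gamma>) (q (real k * \<gamma>))"
  shows "real (card A) * (Q k - q (real k * \<gamma>)) \<le> C + 2 * (real m - 1) * \<gamma>"
proof -
  let ?T = "real k * \<gamma>" and ?S = "real s * \<gamma>"
  have "excess ?S \<le> excess ?T"
    by (rule excess_mono) (use assms mesh Q_range[of k] in \<open>auto intro: mult_right_mono\<close>)
  moreover have "(\<Sum>i<n. x k i) \<le> (\<Sum>i<n. x s i) + (2 * real m - real n) * (real (k - s) * \<gamma>)"
    using sum_run_le[of s "k - s"] assms by simp
  moreover have "(2 * real m - real n) * (real (k - s) * \<gamma>)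
      = (2 * real m - real n) * ?T - (2 * real m - real n) * ?S" using assms(1) by (simp add: of_nat_diff algebra_simps)
  moreover have "real (card A) * (Q k - q ?T)
      \<le> (\<Sum>i<n. clamp (b i) ?T (Q k)) - (\<Sum>i<n. clamp (b i) ?T (q ?T))"
    by (rule sum_clamp_gap) (use assms in auto)
  ultimately show ?thesis
    using sum_clamp_Q_le_shifted[of k] assms(4) sum_shifted[of k] sum_shifted[of s]
    unfolding excess_def by linarith
qed

lemma price_deficit_restart:
  assumes "s \<le> k" "\<forall>j\<in>{s..<k}. Q j < 1" "Q k < q (real k * \<gamma>)"
    and "(\<Sum>i<n. clamp (b i) (real s * \<gamma>) (q (real s * \<gamma>))) \<le> (\<Sum>i<n. shifted s i) + C"
    and "A \<subseteq> {..<n}"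
    and "\<And>i. i \<in> A \<Longrightarrow> q (real k * \<gamma>) - Q k - e
      \<le> clamp (b i) (real k * \<gamma>) (q (real k * \<gamma>)) - clamp (b i) (real k * \<gamma>) (Q k)"
  shows "real (card A) * (q (real k * \<gamma>) - Q k - e) \<le> C + (3 * real n - 2 * real m) * \<gamma>"
proof -
  let ?T = "real k * \<gamma>" and ?S = "real s * \<gamma>"
  have "excess ?T \<le> excess ?S"
    by (rule excess_antimono) (use assms mesh Q_range[of k] in \<open>auto intro: mult_right_mono\<close>)
  moreover have "(\<Sum>i<n. x s i) + (2 * real m - real n) * (real (k - s) * \<gamma>) \<le> (\<Sum>i<n. x k i)"
    using sum_run_ge[of s "k - s"] assms by simp
  moreover have "(2 * real m - real n) * (real (k - s) * \<gamma>)
      = (2 * real m - real n) * ?T - (2 * real m - real n) * ?S" using assms(1) by (simp add: of_nat_diff algebra_simps)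
  moreover have "real (card A) * (q ?T - Q k - e)
      \<le> (\<Sum>i<n. clamp (b i) ?T (q ?T)) - (\<Sum>i<n. clamp (b i) ?T (Q k))"
    by (rule sum_clamp_gap) (use assms in auto)
  ultimately show ?thesis
    using sum_shifted_le_clamp_Q[of k] assms(4) sum_shifted[of k] sum_shifted[of s]
    unfolding excess_def by linarith
qed

lemma cancel_slope:
  assumes "real a * d \<le> real a * (2 * real n * \<gamma>)" "a > 0"
  shows "d \<le> (3 * real n - 1) * \<gamma>"
proof -
  have "d \<le> 2 * real n * \<gamma>" using assms by simp
  also have "\<dots> \<le> (3 * real n - 1) * \<gamma>"
    by (intro mult_right_mono) (use m_real mesh(1) in simp_all)
  finally show ?thesis .
qed

lemma index_m: "m - 1 < n"
  using m_bounds by simp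

lemma Q_travel_0: "\<bar>Q k - x 0 (m - 1)\<bar> \<le> real k * \<gamma>"
  using Q_travel[of 0 k] Q_0 by simp

lemma q_travel_0: "\<bar>q (real k * \<gamma>) - b (m - 1)\<bar> \<le> real k * \<gamma>"
  using q_near_start mesh by simp

lemma price_excess_bound:
  assumes less: "q (real k * \<gamma>) < Q k"
  shows "Q k - q (real k * \<gamma>) \<le> (3 * real n - 1) * \<gamma>"
proof (cases "\<forall>j\<in>{0..<k}. Q j > 0")
  case True
  have "real (card {m - 1}) * (Q k - q (real k * \<gamma>)) \<le> 0 + 2 * (real m - 1) * \<gamma>"
  proof (rule price_excess_restart[where s = 0])
    fix i assume "i \<in> {m - 1}"
    then have i: "i = m - 1" by simp
    show "Q k - q (real k * \<gamma>)
        \<le> clamp (b i) (real k * \<gamma>) (Q k) - clamp (b i) (real k * \<gamma>) (q (real k * \<gamma>))"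
      using Q_travel_0[of k] q_travel_0[of k] discretized[OF index_m]
      unfolding i clamp_def by linarith
  qed (use True less index_m excess_0 in \<open>auto simp: shifted_0 excess_def\<close>)
  also have "\<dots> \<le> (3 * real n - 1) * \<gamma>"
    unfolding add_0 by (intro mult_right_mono) (use m_real mesh(1) in simp_all)
  finally show ?thesis by simp
next
  case False
  then obtain s where s: "s < k" "\<not> Q s > 0" "\<forall>j\<in>{Suc s..<k}. Q j > 0"
    by (rule last_time)
  txt \<open>All \<open>m\<close> winners of step \<open>s\<close> sit at \<open>0\<close>, so that later each of them follows the price: the
    sum of the clamps has slope at least \<open>m\<close>, which pays for the error \<open>2 n \<gamma>\<close> of the restart.\<close>
  then have Qs: "Q s = 0" using Q_range[of s] by simp
  have sk: "real s + 1 \<le> real k" using s(1) by linarith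
  have T: "(real s + 1) * \<gamma> \<le> real k * \<gamma>" by (intro mult_right_mono) (use sk mesh in auto)
  have q0: "0 \<le> q t" if "0 \<le> t" for t using q_range that by simp
  have "real (card (W s)) * (Q k - q (real k * \<gamma>)) \<le> 2 * real n * \<gamma> + 2 * (real m - 1) * \<gamma>"
  proof (rule price_excess_restart[where s = "Suc s"])
    have "shifted (Suc s) i \<le> clamp (b i) (real (Suc s) * \<gamma>) (q (real (Suc s) * \<gamma>)) + 2 * \<gamma>"
      if i: "i < n" for i
      using trichotomy[OF i, of s] Qs x_range[OF i, of s] travel_bound[OF i, of "Suc s"]
        discretized[OF i] mesh winner_step[of i s] winner_le[of i s] loser_step[OF i, of s]
        q0[of "real (Suc s) * \<gamma>"] above_step(2)[OF i, of s]
      unfolding clamp_def shifted_def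
      by (cases "i \<in> W s") (auto simp: algebra_simps min_def max_def split: if_splits)
    then have "(\<Sum>i<n. shifted (Suc s) i) \<le>
        (\<Sum>i<n. clamp (b i) (real (Suc s) * \<gamma>) (q (real (Suc s) * \<gamma>)) + 2 * \<gamma>)"
      by (intro sum_mono) simp
    then show "(\<Sum>i<n. shifted (Suc s) i) \<le>
        (\<Sum>i<n. clamp (b i) (real (Suc s) * \<gamma>) (q (real (Suc s) * \<gamma>))) + 2 * real n * \<gamma>"
      by (simp add: sum.distrib algebra_simps)
  next
    fix i assume i: "i \<in> W s"
    then have n: "i < n" using W_subset by blast
    have "x s i = 0" using winner_le[OF i] x_range[OF n, of s] Qs by simp
    then have "x 0 i \<le> real s * \<gamma>" using travel_bound[OF n, of s] by simp
    moreover have "Q k \<le> real k * \<gamma>"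
    proof -
      have "Q k \<le> real (k - s) * \<gamma>" using Q_travel[of s "k - s"] Qs s(1) by simp
      also have "\<dots> \<le> real k * \<gamma>" by (intro mult_right_mono) (use mesh in auto)
      finally show ?thesis .
    qed
    ultimately show "Q k - q (real k * \<gamma>)
        \<le> clamp (b i) (real k * \<gamma>) (Q k) - clamp (b i) (real k * \<gamma>) (q (real k * \<gamma>))"
      using T discretized[OF n] b_range[OF n] q0[of "real k * \<gamma>"] less mesh
      unfolding clamp_def by (simp add: algebra_simps)
  qed (use s less W_subset in auto)
  also have "\<dots> \<le> real (card (W s)) * (2 * real n * \<gamma>)"
  proof -
    have "0 \<le> (real m - 1) * (real n - 1)" by (intro mult_nonneg_nonneg) (use m_real in auto)
    then have "2 * real n + 2 * (real m - 1) \<le> real m * (2 * real n)" by (simp add: algebra_simps)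
    from mult_right_mono[OF this, of \<gamma>] show ?thesis using mesh by (simp add: card_W algebra_simps)
  qed
  finally show ?thesis by (rule cancel_slope) (simp add: card_W m_pos)
qed

lemma price_deficit_bound:
  assumes less: "Q k < q (real k * \<gamma>)"
  shows "q (real k * \<gamma>) - Q k \<le> (3 * real n - 1) * \<gamma>"
proof (cases "\<forall>j\<in>{0..<k}. Q j < 1")
  case True
  have "real (card {m - 1}) * (q (real k * \<gamma>) - Q k - \<gamma>) \<le> 0 + (3 * real n - 2 * real m) * \<gamma>"
  proof (rule price_deficit_restart[where s = 0])
    fix i assume "i \<in> {m - 1}"
    then have i: "i = m - 1" by simp
    have "clamp (b i) (real k * \<gamma>) (q (real k * \<gamma>)) = q (real k * \<gamma>)"
      using q_travel_0[of k] unfolding i clamp_def by (simp add: abs_le_iff)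
    moreover have "b i - real k * \<gamma> \<le> Q k + \<gamma>"
      using Q_travel_0[of k] discretized[OF index_m] unfolding i by (simp add: abs_le_iff)
    then have "clamp (b i) (real k * \<gamma>) (Q k) \<le> Q k + \<gamma>"
      using mesh(1) unfolding clamp_def by (simp add: min_le_iff_disj)
    ultimately show "q (real k * \<gamma>) - Q k - \<gamma>
        \<le> clamp (b i) (real k * \<gamma>) (q (real k * \<gamma>)) - clamp (b i) (real k * \<gamma>) (Q k)"
      by simp
  qed (use True less index_m excess_0 in \<open>auto simp: shifted_0 excess_def\<close>)
  then have "q (real k * \<gamma>) - Q k \<le> (3 * real n - 2 * real m + 1) * \<gamma>"
    by (simp add: algebra_simps)
  also have "\<dots> \<le> (3 * real n - 1) * \<gamma>"
    by (intro mult_right_mono) (use m_real mesh(1) in simp_all)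
  finally show ?thesis .
next
  case False
  then obtain s where s: "s < k" "\<not> Q s < 1" "\<forall>j\<in>{Suc s..<k}. Q j < 1"
    by (rule last_time)
  then have Qs: "Q s = 1" using Q_range[of s] by simp
  have q1: "q t \<le> 1" if "0 \<le> t" for t using q_range that by simp
  obtain h where h: "h \<in> W s" "x s h = Q s" using holder by blast
  define A where "A = insert h ({..<n} - W s)"
  have A: "A \<subseteq> {..<n}" using h W_subset[of s] by (auto simp: A_def)
  have card_A: "card A = n - m + 1"
    using h card_Diff_subset[OF finite_W W_subset] card_W by (simp add: A_def)
  have "real (card A) * (q (real k * \<gamma>) - Q k - 0) \<le> real n * \<gamma> + (3 * real n - 2 * real m) * \<gamma>"
  proof (rule price_deficit_restart[where s = "Suc s"])
    have "clamp (b i) (real (Suc s) * \<gamma>) (q (real (Suc s) * \<gamma>)) \<le> shifted (Suc s) i + \<gamma>"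
      if i: "i < n" for i
      using trichotomy[OF i, of s] Qs x_range[OF i, of s] travel_bound[OF i, of "Suc s"]
        discretized[OF i] mesh winner_step[of i s] loser_ge[OF i, of s] loser_step[OF i, of s]
        q1[of "real (Suc s) * \<gamma>"] below_step(2)[OF i, of s]
      unfolding clamp_def shifted_def
      by (cases "i \<in> W s") (auto simp: algebra_simps min_def max_def split: if_splits)
    then have "(\<Sum>i<n. clamp (b i) (real (Suc s) * \<gamma>) (q (real (Suc s) * \<gamma>))) \<le>
        (\<Sum>i<n. shifted (Suc s) i + \<gamma>)"
      by (intro sum_mono) simp
    then show "(\<Sum>i<n. clamp (b i) (real (Suc s) * \<gamma>) (q (real (Suc s) * \<gamma>))) \<le>
        (\<Sum>i<n. shifted (Suc s) i) + real n * \<gamma>"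
      by (simp add: sum.distrib)
  next
    fix i assume i: "i \<in> A"
    then have n: "i < n" using A by blast
    have "x s i = 1"
      using i h Qs loser_ge[of i s] x_range[OF n, of s] by (auto simp: A_def)
    then have "1 \<le> x 0 i + real s * \<gamma>" using travel_bound[OF n, of s] by simp
    moreover have "real s * \<gamma> \<le> real k * \<gamma>"
      by (intro mult_right_mono) (use s(1) mesh in auto)
    moreover have "1 - real k * \<gamma> \<le> Q k"
    proof -
      have "1 - real (k - s) * \<gamma> \<le> Q k" using Q_travel[of s "k - s"] Qs s(1) by simp
      moreover have "real (k - s) * \<gamma> \<le> real k * \<gamma>"
        by (intro mult_right_mono) (use mesh in auto)
      ultimately show ?thesis by simp
    qed
    moreover have "q (real k * \<gamma>) \<le> 1" using q1 mesh(1) by simp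
    ultimately have "b i - real k * \<gamma> \<le> Q k" "q (real k * \<gamma>) \<le> b i + real k * \<gamma>"
      using discretized[OF n] b_range[OF n] by linarith+
    then show "q (real k * \<gamma>) - Q k - 0
        \<le> clamp (b i) (real k * \<gamma>) (q (real k * \<gamma>)) - clamp (b i) (real k * \<gamma>) (Q k)"
      using less unfolding clamp_def by simp
  qed (use s less A in auto)
  also have "\<dots> \<le> real (card A) * (2 * real n * \<gamma>)"
  proof -
    have "0 \<le> (real n - real m) * (real n - 1)"
      by (intro mult_nonneg_nonneg) (use m_real in auto)
    then have "real n + (3 * real n - 2 * real m) \<le> (real n - real m + 1) * (2 * real n)"
      by (simp add: algebra_simps)
    from mult_right_mono[OF this, of \<gamma>] show ?thesis
      using mesh m_le_n by (simp add: card_A of_nat_diff algebra_simps)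
  qed
  finally show ?thesis using cancel_slope[of "card A"] card_A by simp
qed

lemma price_error_grid: "\<bar>Q k - q (real k * \<gamma>)\<bar> \<le> (3 * real n - 1) * \<gamma>"
proof -
  have "0 \<le> (3 * real n - 1) * \<gamma>" by (intro mult_nonneg_nonneg) (use m_real mesh in auto)
  then show ?thesis
    using price_excess_bound[of k] price_deficit_bound[of k] by linarith
qed

lemma price_error:
  assumes "real k * \<gamma> \<le> t" "t \<le> real k * \<gamma> + \<gamma>"
  shows "\<bar>Q k - q t\<bar> \<le> (3 * real n + 2) * \<gamma>"
proof -
  have "\<bar>q t - q (real k * \<gamma>)\<bar> \<le> \<gamma>"
    using q_lipschitz[of "real k * \<gamma>" t] assms mesh by simp
  then show ?thesis using price_error_grid[of k] mesh by (simp add: algebra_simps)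
qed

lemma trajectory_error:
  assumes "i < n" "real k * \<gamma> \<le> t" "t \<le> real k * \<gamma> + \<gamma>"
  shows "\<bar>x k i - clamp (b i) t (q t)\<bar> \<le> (3 * real n + 2) * \<gamma>"
proof -
  have "\<bar>clamp (b i) (real k * \<gamma>) (Q k) - clamp (b i) (real k * \<gamma>) (q (real k * \<gamma>))\<bar> \<le> (3 * real n - 1) * \<gamma>"
    using clamp_lipschitz[of "b i" "real k * \<gamma>" "Q k" "b i" "real k * \<gamma>" "q (real k * \<gamma>)"]
      price_error_grid[of k] by simp
  moreover have "\<bar>clamp (b i) (real k * \<gamma>) (q (real k * \<gamma>)) - clamp (b i) t (q t)\<bar> \<le> \<gamma>"
    using clamp_lipschitz[of "b i" "real k * \<gamma>" "q (real k * \<gamma>)" "b i" t "q t"]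
      q_lipschitz[of "real k * \<gamma>" t] assms mesh by simp
  ultimately show ?thesis
    using bid_error[OF assms(1), of k] by (simp add: algebra_simps)
qed

end

section \<open>Reduction to sorted bids\<close>

lemma length_sorted: "length (sorted_list_of_multiset B) = size B"
  by (metis mset_sorted_list_of_multiset size_mset)

lemma sum_mset_sorted:
  "(\<Sum>b\<in>#B. f b) = (\<Sum>i<size B. f (sorted_list_of_multiset B ! i))"
proof -
  have "(\<Sum>b\<in>#B. f b) = sum_list (map f (sorted_list_of_multiset B))"
    by (metis mset_map mset_sorted_list_of_multiset sum_mset_sum_list)
  then show ?thesis by (simp add: sum_list_sum_nth atLeast0LessThan length_sorted)
qed

lemma cdf_card:
  "cdf B x = real (card {i. i < size B \<and> sorted_list_of_multiset B ! i \<le> x}) / real (size B)"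
proof -
  have "{..<size B} \<inter> {i. sorted_list_of_multiset B ! i \<le> x}
      = {i. i < size B \<and> sorted_list_of_multiset B ! i \<le> x}" by auto
  then show ?thesis by (simp add: cdf_def sum_mset_sorted of_bool_def sum.If_cases)
qed

lemma cdf_left_card:
  "cdf_left B x = real (card {i. i < size B \<and> sorted_list_of_multiset B ! i < x}) / real (size B)"
proof -
  let ?b = "\<lambda>i. sorted_list_of_multiset B ! i"
  have "\<forall>\<^sub>F y in at_left x. \<forall>i\<in>{..<size B}. ?b i \<le> y \<longleftrightarrow> ?b i < x"
  proof (intro eventually_ball_finite ballI)
    fix i
    show "\<forall>\<^sub>F y in at_left x. ?b i \<le> y \<longleftrightarrow> ?b i < x"
    proof (cases "?b i < x")
      case True
      from eventually_at_left_real[OF this] show ?thesis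
        by eventually_elim (use True in auto)
    next
      case False
      from eventually_at_left_real[of "x - 1" x] show ?thesis
        by (rule eventually_mono) (use False in auto)
    qed
  qed simp
  then have "\<forall>\<^sub>F y in at_left x. cdf B y
      = real (card {i. i < size B \<and> ?b i < x}) / real (size B)"
    unfolding cdf_card by eventually_elim (auto intro!: arg_cong[of _ _ card])
  then show ?thesis
    unfolding cdf_left_def by (intro tendsto_Lim tendsto_eventually) auto
qed

lemma num_winners_eq:
  assumes "p * real n \<in> \<nat>"
  shows "real (num_winners p n) = p * real n"
proof -
  obtain k where "p * real n = real k" using assms by (auto elim: Nats_cases)
  then show ?thesis by (simp add: num_winners_def mult.commute)
qed

lemma quantile_eq:
  assumes "p * real (size B) = real m" "1 \<le> m" "m \<le> size B" "set_mset B \<subseteq> {0..1}"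
  shows "quantile B p = sorted_list_of_multiset B ! (m - 1)"
proof -
  let ?b = "\<lambda>i. sorted_list_of_multiset B ! i" and ?n = "size B"
  have mono: "?b i \<le> ?b j" if "i \<le> j" "j < ?n" for i j
    using that sorted_sorted_list_of_multiset[of B]
    by (simp add: sorted_iff_nth_mono length_sorted)
  have "sorted_list_of_multiset B ! (m - 1) \<in># B"
    using assms by (metis One_nat_def diff_less length_sorted less_le_trans mset_sorted_list_of_multiset
        nth_mem_mset zero_less_one)
  then have nonneg: "0 \<le> ?b (m - 1)" using assms by auto
  have "p \<le> cdf B x \<longleftrightarrow> ?b (m - 1) \<le> x" for x
  proof -
    have n: "real ?n > 0" using assms(2,3) by simp
    have "p = real m / real ?n" using assms(1) n by (metis less_irrefl nonzero_eq_divide_eq)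
    then have "p \<le> cdf B x \<longleftrightarrow> m \<le> card {i. i < ?n \<and> ?b i \<le> x}"
      unfolding cdf_card using n by (simp add: divide_le_cancel)
    also have "\<dots> \<longleftrightarrow> ?b (m - 1) \<le> x"
    proof
      assume le: "m \<le> card {i. i < ?n \<and> ?b i \<le> x}"
      show "?b (m - 1) \<le> x"
      proof (rule ccontr)
        assume "\<not> ?thesis"
        then have "{i. i < ?n \<and> ?b i \<le> x} \<subseteq> {..<m - 1}"
          using mono by (auto simp: not_le intro: leI) (meson leI le_less_trans not_less)
        then have "card {i. i < ?n \<and> ?b i \<le> x} \<le> m - 1"
          using card_mono[of "{..<m - 1}"] by simp
        then show False using le assms by simp
      qed
    next
      assume le: "?b (m - 1) \<le> x"
      have "{..<m} \<subseteq> {i. i < ?n \<and> ?b i \<le> x}"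
      proof
        fix i assume "i \<in> {..<m}"
        then have "i \<le> m - 1" "m - 1 < ?n" "i < ?n" using assms by auto
        then show "i \<in> {i. i < ?n \<and> ?b i \<le> x}" using mono[of i "m - 1"] le by simp
      qed
      then show "m \<le> card {i. i < ?n \<and> ?b i \<le> x}"
        using card_mono[of "{i. i < ?n \<and> ?b i \<le> x}" "{..<m}"] by simp
    qed
    finally show ?thesis .
  qed
  then have "{x. 0 \<le> x \<and> p \<le> cdf B x} = {?b (m - 1)..}" using nonneg by auto
  then show ?thesis unfolding quantile_def by simp
qed

lemma drift_card:
  assumes "p * real (size B) = real m" "B \<noteq> {#}"
  defines "b \<equiv> \<lambda>i. sorted_list_of_multiset B ! i" and "n \<equiv> size B"
  shows "drift p B q t =
    (2 * real m - real n - real (card {i. i < n \<and> b i < q t - t}) + real (card {i. i < n \<and> q t + t < b i}))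
    / (real n - real (card {i. i < n \<and> b i < q t - t}) - real (card {i. i < n \<and> q t + t < b i}))"
proof -
  have n: "real n > 0" using assms(2) by (simp add: n_def nonempty_has_size)
  have p: "p = real m / real n"
    using assms(1) n unfolding n_def by (metis less_irrefl nonzero_eq_divide_eq)
  have "{i. i < n \<and> b i \<le> q t + t} = {..<n} - {i. i < n \<and> q t + t < b i}" by auto
  then have "card {i. i < n \<and> b i \<le> q t + t} = n - card {i. i < n \<and> q t + t < b i}"
    by (simp add: card_Diff_subset[of "{i. i < n \<and> q t + t < b i}"] subset_iff)
  moreover have "card {i. i < n \<and> q t + t < b i} \<le> card {..<n}" by (intro card_mono) auto
  ultimately have at_most: "real (card {i. i < n \<and> b i \<le> q t + t})
      = real n - real (card {i. i < n \<and> q t + t < b i})"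
    by (simp add: of_nat_diff)
  have w: "win_rate p B q t = (real m - real (card {i. i < n \<and> b i < q t - t})) / real n"
    unfolding win_rate_def cdf_left_card p using n by (simp add: b_def n_def diff_divide_distrib)
  have l: "lose_rate p B q t
      = (real n - real (card {i. i < n \<and> q t + t < b i}) - real m) / real n"
    unfolding lose_rate_def cdf_card p using at_most n by (simp add: b_def n_def diff_divide_distrib)
  have cancel: "(v / real n - v' / real n) / (v / real n + v' / real n) = (v - v') / (v + v')"
    for v v' :: real
    using n by (simp flip: add_divide_distrib diff_divide_distrib)
  show ?thesis
    unfolding drift_def w l cancel by (intro arg_cong2[of _ _ _ _ "(/)"]) simp_all
qed

lemma auction_of_max_price:
  assumes "p * real (size B) = real m" "1 \<le> m" "m \<le> size B" "set_mset B \<subseteq> {0..1}"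
    and mp: "max_price p B q"
  shows "continuous_auction (size B) m (\<lambda>i. sorted_list_of_multiset B ! i) q (drift p B q)
    (\<lambda>t. if q t = 0 then max 0 (drift p B q t) else if q t = 1 then min 0 (drift p B q t)
      else drift p B q t)"
proof
  show "sorted_list_of_multiset B ! i \<le> sorted_list_of_multiset B ! j"
    if "i \<le> j" "j < size B" for i j
    using that sorted_sorted_list_of_multiset[of B]
    by (simp add: sorted_iff_nth_mono length_sorted)
  show "0 \<le> sorted_list_of_multiset B ! i \<and> sorted_list_of_multiset B ! i \<le> 1"
    if "i < size B" for i
  proof -
    have "sorted_list_of_multiset B ! i \<in># B"
      using that by (metis length_sorted mset_sorted_list_of_multiset nth_mem_mset)
    then show ?thesis using assms(4) by auto
  qed
  show "q 0 = sorted_list_of_multiset B ! (m - 1)"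
    using mp quantile_eq[OF assms(1-4)] by (simp add: max_price_def)
  show "continuous_on {0..} q" using mp by (simp add: max_price_def)
  show "(q t = 0 \<longrightarrow> drift p B q t \<le> 0) \<and> (q t = 1 \<longrightarrow> 0 \<le> drift p B q t)" if "t > 0" for t
    using mp that by (simp add: max_price_def)
  show "drift p B q t = (2 * real m - real (size B)
      - real (card {i. i < size B \<and> sorted_list_of_multiset B ! i < q t - t})
      + real (card {i. i < size B \<and> q t + t < sorted_list_of_multiset B ! i}))
    / (real (size B) - real (card {i. i < size B \<and> sorted_list_of_multiset B ! i < q t - t})
      - real (card {i. i < size B \<and> q t + t < sorted_list_of_multiset B ! i}))" for t
    by (rule drift_card) (use assms in auto)
qed (use assms max_price_local[OF mp] in auto)

lemma max_price_0:
  assumes mp: "max_price 0 B q" and "set_mset B \<subseteq> {0..1}" "B \<noteq> {#}" "0 \<le> t"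
  shows "q t = 0"
proof -
  let ?b = "\<lambda>i. sorted_list_of_multiset B ! i"
  have nonneg: "0 \<le> ?b i" if "i < size B" for i
  proof -
    have "?b i \<in># B" using that by (metis length_sorted mset_sorted_list_of_multiset nth_mem_mset)
    then show ?thesis using assms(2) by auto
  qed
  have cont: "continuous_on {0..t} q"
    using mp by (auto simp: max_price_def intro: continuous_on_subset)
  have "{x. 0 \<le> x \<and> 0 \<le> cdf B x} = {0..}" by (auto simp: cdf_card)
  then have q_0: "q 0 = 0" using mp by (simp add: max_price_def quantile_def)
  have "\<bar>q t\<bar> \<le> 0"
  proof (rule right_induct_le[OF assms(4)])
    show "continuous_on {0..t} (\<lambda>r. \<bar>q r\<bar>)" by (intro continuous_intros cont)
    show "\<bar>q 0\<bar> \<le> 0" using q_0 by simp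
  next
    fix r assume r: "0 \<le> r" "\<bar>q r\<bar> \<le> 0"
    then have q: "q r = 0" by simp
    have "{i. i < size B \<and> ?b i < q r - r} = {}" using nonneg q r by force
    then have "win_rate 0 B q r = 0" unfolding win_rate_def cdf_left_card by simp
    then have "drift 0 B q r \<le> 0" by (simp add: drift_def divide_le_0_iff)
    then show "\<forall>\<^sub>F h in at_right 0. \<bar>q (r + h)\<bar> \<le> 0"
      using max_price_local[OF mp r(1)] q by simp
  qed
  then show ?thesis by simp
qed

lemma mset_relisting:
  assumes "bij_betw \<sigma> {..<n} {..<n}"
  shows "mset (map (\<lambda>j. f (\<sigma> j)) [0..<n]) = mset (map f [0..<n])"
proof -
  have "mset (map \<sigma> [0..<n]) = mset_set (\<sigma> ` {..<n})"
    using assms image_mset_mset_set[of \<sigma> "{..<n}"]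
    by (simp add: bij_betw_def atLeast0LessThan)
  also have "\<dots> = mset [0..<n]"
    using assms by (simp add: bij_betw_def atLeast0LessThan)
  finally have "image_mset f (mset (map \<sigma> [0..<n])) = image_mset f (mset [0..<n])"
    by (rule arg_cong)
  then show ?thesis by (simp only: mset_map[symmetric] map_map o_def)
qed

lemma sorted_listing:
  fixes f :: "nat \<Rightarrow> real"
  assumes "bij_betw \<sigma> {..<n} {..<n}" "mono_on {..<n} (\<lambda>j. f (\<sigma> j))"
  shows "sorted_list_of_multiset (mset (map f [0..<n])) = map (\<lambda>j. f (\<sigma> j)) [0..<n]"
proof -
  have "mset (map (\<lambda>j. f (\<sigma> j)) [0..<n]) = mset (map f [0..<n])"
    by (rule mset_relisting[OF assms(1)])
  moreover have "sorted (map (\<lambda>j. f (\<sigma> j)) [0..<n])"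
    using assms(2) by (auto simp: sorted_iff_nth_mono mono_on_def)
  ultimately have "sort (map f [0..<n]) = map (\<lambda>j. f (\<sigma> j)) [0..<n]"
    by (intro properties_for_sort)
  then show ?thesis by (simp only: sorted_list_of_multiset_mset)
qed

lemma trajectories_mset:
  assumes "discrete_trajectories \<gamma> p B x"
  shows "mset (map (x k) [0..<size B]) = (discrete_step \<gamma> p ^^ k) (image_mset (discretize \<gamma>) B)"
proof (induction k)
  case 0
  have "map (x 0) [0..<size B] = map (discretize \<gamma>) (sorted_list_of_multiset B)"
    using assms by (intro nth_equalityI) (auto simp: discrete_trajectories_def Let_def length_sorted)
  then show ?case by (simp only: mset_map mset_sorted_list_of_multiset funpow_0)
next
  case (Suc k)
  let ?n = "size B"
  obtain \<sigma> where \<sigma>: "bij_betw \<sigma> {..<?n} {..<?n}" "mono_on {..<?n} (\<lambda>j. x k (\<sigma> j))"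
    and step: "\<And>j. j < ?n \<Longrightarrow> x (Suc k) (\<sigma> j) = move \<gamma> (num_winners p ?n) j (x k (\<sigma> j))"
    using assms unfolding discrete_trajectories_def Let_def by metis
  have "(discrete_step \<gamma> p ^^ Suc k) (image_mset (discretize \<gamma>) B)
      = discrete_step \<gamma> p (mset (map (x k) [0..<?n]))"
    using Suc by simp
  also have "\<dots> = mset (map (\<lambda>i. move \<gamma> (num_winners p ?n) i (map (\<lambda>j. x k (\<sigma> j)) [0..<?n] ! i)) [0..<?n])"
    unfolding discrete_step_def Let_def sorted_listing[OF \<sigma>] by (simp only: size_mset length_map length_upt) simp
  also have "\<dots> = mset (map (\<lambda>j. x (Suc k) (\<sigma> j)) [0..<?n])"
    by (intro arg_cong[of _ _ mset] map_cong) (auto simp: step)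
  also have "\<dots> = mset (map (x (Suc k)) [0..<?n])" by (rule mset_relisting[OF \<sigma>(1)])
  finally show ?case by simp
qed

lemma discretize_bounds:
  assumes "\<gamma> > 0"
  shows "discretize \<gamma> b \<le> b" "b < discretize \<gamma> b + \<gamma>"
proof -
  have "of_int \<lfloor>b / \<gamma>\<rfloor> * \<gamma> \<le> b" by (rule pos_le_divide_eq[OF assms, THEN iffD1]) linarith
  moreover have "b < (of_int \<lfloor>b / \<gamma>\<rfloor> + 1) * \<gamma>"
    by (rule pos_divide_less_eq[OF assms, THEN iffD1]) linarith
  ultimately show "discretize \<gamma> b \<le> b" "b < discretize \<gamma> b + \<gamma>"
    by (simp_all add: discretize_def algebra_simps)
qed

lemma num_steps_bounds:
  assumes "\<gamma> > 0" "0 \<le> t"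
  shows "real (num_steps \<gamma> t) * \<gamma> \<le> t" "t \<le> real (num_steps \<gamma> t) * \<gamma> + \<gamma>"
proof -
  have "real (num_steps \<gamma> t) = of_int \<lfloor>t / \<gamma>\<rfloor>" using assms by (simp add: num_steps_def)
  moreover have "of_int \<lfloor>t / \<gamma>\<rfloor> * \<gamma> \<le> t"
    by (rule pos_le_divide_eq[OF assms(1), THEN iffD1]) linarith
  moreover have "t < (of_int \<lfloor>t / \<gamma>\<rfloor> + 1) * \<gamma>"
    by (rule pos_divide_less_eq[OF assms(1), THEN iffD1]) linarith
  ultimately show "real (num_steps \<gamma> t) * \<gamma> \<le> t" "t \<le> real (num_steps \<gamma> t) * \<gamma> + \<gamma>"
    by (simp_all add: algebra_simps)
qed

lemma discrete_bids_of_trajectories: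
  assumes "\<gamma> > 0" "\<gamma> * real N = 1" "set_mset B \<subseteq> {0..1}"
    and traj: "discrete_trajectories \<gamma> p B x"
    and m: "num_winners p (size B) = m" "1 \<le> m" "m \<le> size B"
  obtains W where "discrete_bids \<gamma> N (size B) m x
    (\<lambda>k. sorted_list_of_multiset (mset (map (x k) [0..<size B])) ! (m - 1)) W"
proof -
  let ?n = "size B"
  define Q where "Q k = sorted_list_of_multiset (mset (map (x k) [0..<?n])) ! (m - 1)" for k
  have x0: "x 0 i = discretize \<gamma> (sorted_list_of_multiset B ! i)" if "i < ?n" for i
    using traj that by (simp add: discrete_trajectories_def Let_def)
  have "\<forall>k. \<exists>\<sigma>. bij_betw \<sigma> {..<?n} {..<?n} \<and> mono_on {..<?n} (\<lambda>j. x k (\<sigma> j)) \<and>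
      (\<forall>j<?n. x (Suc k) (\<sigma> j) = move \<gamma> m j (x k (\<sigma> j)))"
    using traj m by (simp add: discrete_trajectories_def Let_def)
  then obtain \<sigma> where bij: "\<And>k. bij_betw (\<sigma> k) {..<?n} {..<?n}"
    and mono: "\<And>k. mono_on {..<?n} (\<lambda>j. x k (\<sigma> k j))"
    and step: "\<And>k j. j < ?n \<Longrightarrow> x (Suc k) (\<sigma> k j) = move \<gamma> m j (x k (\<sigma> k j))"
    by metis
  have Q: "Q k = x k (\<sigma> k (m - 1))" for k
  proof -
    have "m - 1 < ?n" using m by linarith
    then show ?thesis unfolding Q_def sorted_listing[OF bij mono] by simp
  qed
  have le: "x k (\<sigma> k i) \<le> x k (\<sigma> k j)" if "i \<le> j" "j < ?n" for i j k
    using mono[of k] that by (auto simp: mono_on_def)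
  define W where "W k = \<sigma> k ` {..<m}" for k
  have inj: "inj_on (\<sigma> k) {..<?n}" for k using bij by (simp add: bij_betw_def)
  have loserE: "\<exists>j. m \<le> j \<and> j < ?n \<and> i = \<sigma> k j" if "i < ?n" "i \<notin> W k" for i k
  proof -
    have "i \<in> \<sigma> k ` {..<?n}" using bij[of k] that by (simp add: bij_betw_def)
    then obtain j where "j < ?n" "i = \<sigma> k j" by auto
    then show ?thesis using that(2) by (intro exI[of _ j]) (auto simp: W_def not_le[symmetric])
  qed
  have "discrete_bids \<gamma> N ?n m x Q W"
  proof
    show "\<exists>z. x 0 i = \<gamma> * of_int z" if "i < ?n" for i
      using x0[OF that] unfolding discretize_def by blast
    show "0 \<le> x 0 i \<and> x 0 i \<le> 1" if "i < ?n" for i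
    proof -
      have "sorted_list_of_multiset B ! i \<in># B"
        using that by (metis length_sorted mset_sorted_list_of_multiset nth_mem_mset)
      then have b: "0 \<le> sorted_list_of_multiset B ! i" "sorted_list_of_multiset B ! i \<le> 1"
        using assms(3) by auto
      then have "0 \<le> x 0 i" using assms(1) x0[OF that] by (simp add: discretize_def)
      then show ?thesis
        using discretize_bounds(1)[OF assms(1), of "sorted_list_of_multiset B ! i"] b x0[OF that]
        by linarith
    qed
    show "W k \<subseteq> {..<?n}" for k
    proof -
      have "W k \<subseteq> \<sigma> k ` {..<?n}" using m by (auto simp: W_def)
      then show ?thesis using bij[of k] by (simp add: bij_betw_def)
    qed
    show "card (W k) = m" for k
      unfolding W_def using m by (subst card_image) (auto intro: inj_on_subset[OF inj])
    show "\<exists>i\<in>W k. x k i = Q k" for k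
      using m by (auto simp: W_def Q intro!: bexI[of _ "m - 1"])
    show "x k i \<le> Q k" if "i \<in> W k" for k i
      using that m le[of _ "m - 1" k] by (auto simp: W_def Q)
    show "x (Suc k) i = min 1 (x k i + \<gamma>)" if "i \<in> W k" for k i
      using that m step[of _ k] by (auto simp: W_def move_def)
    show "Q k \<le> x k i" if "i < ?n" "i \<notin> W k" for k i
      using loserE[OF that] m le[of "m - 1" _ k] by (auto simp: Q)
    show "x (Suc k) i = max 0 (x k i - \<gamma>)" if "i < ?n" "i \<notin> W k" for k i
      using loserE[OF that] step[of _ k] by (auto simp: move_def)
  qed (use assms in auto)
  then show thesis using that unfolding Q_def by blast
qed

lemma all_losers:
  assumes "discrete_trajectories \<gamma> p B x" "num_winners p (size B) = 0" "0 < \<gamma>"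
    and "i < size B" "0 \<le> sorted_list_of_multiset B ! i"
  shows "x k i = max 0 (discretize \<gamma> (sorted_list_of_multiset B ! i) - real k * \<gamma>)"
proof (induction k)
  case 0
  have "0 \<le> discretize \<gamma> (sorted_list_of_multiset B ! i)"
    using assms by (simp add: discretize_def)
  then show ?case using assms by (simp add: discrete_trajectories_def Let_def)
next
  case (Suc k)
  obtain \<sigma> where bij: "bij_betw \<sigma> {..<size B} {..<size B}"
    and step: "\<And>j. j < size B \<Longrightarrow> x (Suc k) (\<sigma> j) = move \<gamma> 0 j (x k (\<sigma> j))"
    using assms(1,2) unfolding discrete_trajectories_def Let_def by metis
  have "i \<in> \<sigma> ` {..<size B}" using bij assms(4) by (simp add: bij_betw_def)
  then have "x (Suc k) i = max 0 (x k i - \<gamma>)" using step by (auto simp: move_def)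
  then show ?case using Suc assms(3) by (auto simp: algebra_simps max_def)
qed

theorem theorem4p1:
  fixes p \<gamma> :: real and N :: nat and B :: "real multiset"
    and q :: "real \<Rightarrow> real" and x :: "nat \<Rightarrow> nat \<Rightarrow> real"
  assumes "p \<in> {0..1}" and "B \<noteq> {#}" and "p * real (size B) \<in> \<nat>"
    and "set_mset B \<subseteq> {0..1}"
    and "N > 0" and "\<gamma> = 1 / real N"
    and "max_price p B q"
    and "discrete_trajectories \<gamma> p B x"
  shows "(SUP t\<in>{0..}. ereal \<bar>discrete_max_price \<gamma> p B t - q t\<bar>)
           \<le> ereal ((3 * real (size B) + 2) * \<gamma>) \<and>
         (SUP i\<in>{..<size B}. SUP t\<in>{0..}.
            ereal \<bar>x (num_steps \<gamma> t) i - bid_at q t (sorted_list_of_multiset B ! i)\<bar>)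
           \<le> ereal ((3 * real (size B) + 2) * \<gamma>)"
proof -
  define n where "n = size B"
  define b where "b i = sorted_list_of_multiset B ! i" for i
  define m where "m = num_winners p n"
  have \<gamma>: "\<gamma> > 0" "\<gamma> * real N = 1" using assms by simp_all
  have n: "n > 0" using assms(2) by (simp add: n_def nonempty_has_size)
  have pm: "p * real n = real m" using num_winners_eq assms(3) by (simp add: m_def n_def)
  have "p * real n \<le> 1 * real n" by (rule mult_right_mono) (use assms(1) in auto)
  then have m_n: "m \<le> n" using pm by simp
  have b_range: "0 \<le> b i \<and> b i \<le> 1" if "i < n" for i
  proof -
    have "b i \<in># B"
      using that unfolding b_def n_def by (metis length_sorted mset_sorted_list_of_multiset nth_mem_mset)
    then show ?thesis using assms(4) by auto
  qed
  have price_nth: "discrete_max_price \<gamma> p B t = (if m = 0 then 0 else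
      sorted_list_of_multiset (mset (map (x (num_steps \<gamma> t)) [0..<n])) ! (m - 1))" for t
    unfolding discrete_max_price_def discrete_evolution_def Let_def n_def m_def
      trajectories_mset[OF assms(8)] ..
  have "\<bar>discrete_max_price \<gamma> p B t - q t\<bar> \<le> (3 * real n + 2) * \<gamma> \<and>
      (\<forall>i<n. \<bar>x (num_steps \<gamma> t) i - bid_at q t (b i)\<bar> \<le> (3 * real n + 2) * \<gamma>)"
    if t: "0 \<le> t" for t
  proof (cases "m = 0")
    case True
    then have "p = 0" using pm n by simp
    then have q: "q t = 0" using max_price_0 assms t by blast
    have bound: "\<gamma> \<le> (3 * real n + 2) * \<gamma>" using \<gamma>(1) by simp
    have "\<bar>x (num_steps \<gamma> t) i - bid_at q t (b i)\<bar> \<le> \<gamma>" if i: "i < n" for i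
    proof -
      have "x (num_steps \<gamma> t) i = max 0 (discretize \<gamma> (b i) - real (num_steps \<gamma> t) * \<gamma>)"
        using all_losers[OF assms(8) _ \<gamma>(1), of i] True i b_range[OF i] by (simp add: m_def n_def b_def)
      moreover have "bid_at q t (b i) = max 0 (b i - t)"
        using q t b_range[OF i] by (auto simp: bid_at_def)
      ultimately show ?thesis
        using discretize_bounds[OF \<gamma>(1), of "b i"] num_steps_bounds[OF \<gamma>(1) t] by linarith
    qed
    then have "\<forall>i<n. \<bar>x (num_steps \<gamma> t) i - bid_at q t (b i)\<bar> \<le> (3 * real n + 2) * \<gamma>"
      using bound order_trans by blast
    moreover have "discrete_max_price \<gamma> p B t = 0" using price_nth True by simp
    ultimately show ?thesis using bound q \<gamma>(1) by simp
  next
    case False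
    then have m1: "1 \<le> m" by simp
    define Q where "Q k = sorted_list_of_multiset (mset (map (x k) [0..<n])) ! (m - 1)" for k
    obtain W where W: "discrete_bids \<gamma> N n m x Q W"
      using discrete_bids_of_trajectories[OF \<gamma> assms(4,8), of m] m1 m_n
      unfolding Q_def m_def n_def by blast
    obtain c where c: "continuous_auction n m b q (drift p B q) c"
      using auction_of_max_price[OF _ m1 _ assms(4,7)] pm m_n unfolding n_def b_def by blast
    interpret discrete_bids \<gamma> N n m x Q W by (rule W)
    interpret continuous_auction n m b q "drift p B q" c by (rule c)
    have x0: "x 0 i = discretize \<gamma> (b i)" if "i < n" for i
      using assms(8) that by (simp add: discrete_trajectories_def Let_def b_def n_def)
    interpret discrete_vs_continuous \<gamma> N n m x Q W b q "drift p B q" c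
    proof
      show "x 0 i \<le> b i \<and> b i < x 0 i + \<gamma>" if "i < n" for i
        using discretize_bounds[OF \<gamma>(1)] x0[OF that] by simp
      have "mono_on {..<n} (\<lambda>j. x 0 (id j))"
      proof (rule mono_onI)
        fix i j assume ij: "i \<in> {..<n}" "j \<in> {..<n}" "i \<le> j"
        then have "b i / \<gamma> \<le> b j / \<gamma>" using b_sorted \<gamma>(1) by (simp add: divide_right_mono)
        then show "x 0 (id i) \<le> x 0 (id j)"
          using ij \<gamma>(1) by (simp add: x0 discretize_def floor_mono)
      qed
      then have "sorted_list_of_multiset (mset (map (x 0) [0..<n])) = map (\<lambda>j. x 0 (id j)) [0..<n]"
        by (rule sorted_listing[OF bij_betw_id])
      then show "Q 0 = x 0 (m - 1)" using m1 m_n by (simp add: Q_def)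
    qed
    have "discrete_max_price \<gamma> p B t = Q (num_steps \<gamma> t)"
      using False by (simp add: price_nth Q_def)
    then show ?thesis
      using price_error trajectory_error num_steps_bounds[OF \<gamma>(1) t] t
      by (simp add: bid_at_clamp)
  qed
  then show ?thesis
    unfolding n_def b_def by (intro conjI SUP_least) simp_all
qed

end
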